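(* Let $I\in\mathbb{S}$ be fixed. For any $f\in L^2(\mathbb{R},\mathbb{H})$, $$\|\mathcal{V}_\varphi f\|_{L^2(\mathbb{R}^2,\mathbb{H})}=\sqrt2\,\|f\|_{L^2(\mathbb{R},\mathbb{H})}.$$
   Context: $\mathbb{H}$ is the algebra of real quaternions, $\mathbb{S}=\{q\in\mathbb{H}:q^2=-1\}$. $L^2(\mathbb{R},\mathbb{H})$ and $L^2(\mathbb{R}^2,\mathbb{H})$ are the spaces of square integrable $\mathbb{H}$-valued functions with inner product $\langle F,G\rangle=\int\overline{G}F$ and the associated norms. The quaternionic Segal-Bargmann transform with parameter $\nu=2\pi$ is $\mathcal{B}^S_{\mathbb{H}}(f)(q)=\int_{\mathbb{R}}2^{3/4}e^{-\pi(q^2+t^2)+2\pi\sqrt2\,qt}f(t)\,dt$, $q\in\mathbb{H}$. Let $\varphi(t)=2^{1/4}e^{-\pi t^2}$. For $I\in\mathbb{S}$ fixed, the 1D quaternion short-time Fourier transform (QSTFT) of $f\in L^2(\mathbb{R},\mathbb{H})$ with window $\varphi$ is $$\mathcal{V}_\varphi f(x,\omega)=e^{-I\pi x\omega}\,\mathcal{B}^S_{\mathbb{H}}(f)\!\left(\frac{\bar q}{\sqrt2}\right)e^{-\frac{\pi|q|^2}{2}},\qquad q=x+I\omega,\ (x,\omega)\in\mathbb{R}^2.$$ *)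

theory Defs
  imports "HOL-Analysis.Analysis"
begin

section \<open>The algebra of real quaternions\<close>

datatype quat = Quat (Re: real) (Im1: real) (Im2: real) (Im3: real)

hide_const (open) Re Im1 Im2 Im3

lemma quat_eq_iff:
  "x = y \<longleftrightarrow> quat.Re x = quat.Re y \<and> quat.Im1 x = quat.Im1 y
     \<and> quat.Im2 x = quat.Im2 y \<and> quat.Im3 x = quat.Im3 y"
  by (cases x; cases y) simp

instantiation quat :: real_vector
begin

definition "0 = Quat 0 0 0 0"
definition "x + y = Quat (quat.Re x + quat.Re y) (quat.Im1 x + quat.Im1 y)
  (quat.Im2 x + quat.Im2 y) (quat.Im3 x + quat.Im3 y)"
definition "- x = Quat (- quat.Re x) (- quat.Im1 x) (- quat.Im2 x) (- quat.Im3 x)"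
definition "x - y = Quat (quat.Re x - quat.Re y) (quat.Im1 x - quat.Im1 y)
  (quat.Im2 x - quat.Im2 y) (quat.Im3 x - quat.Im3 y)"
definition "scaleR r x = Quat (r * quat.Re x) (r * quat.Im1 x) (r * quat.Im2 x) (r * quat.Im3 x)"

instance
  by standard
    (auto simp: zero_quat_def plus_quat_def uminus_quat_def minus_quat_def scaleR_quat_def
      algebra_simps)

end

lemma quat_linear_simps [simp]:
  "quat.Re 0 = 0" "quat.Im1 0 = 0" "quat.Im2 0 = 0" "quat.Im3 0 = 0"
  "quat.Re (x + y) = quat.Re x + quat.Re y" "quat.Im1 (x + y) = quat.Im1 x + quat.Im1 y"
  "quat.Im2 (x + y) = quat.Im2 x + quat.Im2 y" "quat.Im3 (x + y) = quat.Im3 x + quat.Im3 y"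
  "quat.Re (- x) = - quat.Re x" "quat.Im1 (- x) = - quat.Im1 x"
  "quat.Im2 (- x) = - quat.Im2 x" "quat.Im3 (- x) = - quat.Im3 x"
  "quat.Re (x - y) = quat.Re x - quat.Re y" "quat.Im1 (x - y) = quat.Im1 x - quat.Im1 y"
  "quat.Im2 (x - y) = quat.Im2 x - quat.Im2 y" "quat.Im3 (x - y) = quat.Im3 x - quat.Im3 y"
  "quat.Re (scaleR r x) = r * quat.Re x" "quat.Im1 (scaleR r x) = r * quat.Im1 x"
  "quat.Im2 (scaleR r x) = r * quat.Im2 x" "quat.Im3 (scaleR r x) = r * quat.Im3 x"
  by (simp_all add: zero_quat_def plus_quat_def uminus_quat_def minus_quat_def scaleR_quat_def)

instantiation quat :: real_algebra_1
begin

definition "1 = Quat 1 0 0 0"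
definition "x * y = Quat
  (quat.Re x * quat.Re y - quat.Im1 x * quat.Im1 y - quat.Im2 x * quat.Im2 y - quat.Im3 x * quat.Im3 y)
  (quat.Re x * quat.Im1 y + quat.Im1 x * quat.Re y + quat.Im2 x * quat.Im3 y - quat.Im3 x * quat.Im2 y)
  (quat.Re x * quat.Im2 y - quat.Im1 x * quat.Im3 y + quat.Im2 x * quat.Re y + quat.Im3 x * quat.Im1 y)
  (quat.Re x * quat.Im3 y + quat.Im1 x * quat.Im2 y - quat.Im2 x * quat.Im1 y + quat.Im3 x * quat.Re y)"

instance
  by standard (simp_all add: quat_eq_iff one_quat_def times_quat_def algebra_simps)

end

lemma quat_mult_simps [simp]:
  "quat.Re 1 = 1" "quat.Im1 1 = 0" "quat.Im2 1 = 0" "quat.Im3 1 = 0"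
  "quat.Re (x * y) = quat.Re x * quat.Re y - quat.Im1 x * quat.Im1 y - quat.Im2 x * quat.Im2 y - quat.Im3 x * quat.Im3 y"
  "quat.Im1 (x * y) = quat.Re x * quat.Im1 y + quat.Im1 x * quat.Re y + quat.Im2 x * quat.Im3 y - quat.Im3 x * quat.Im2 y"
  "quat.Im2 (x * y) = quat.Re x * quat.Im2 y - quat.Im1 x * quat.Im3 y + quat.Im2 x * quat.Re y + quat.Im3 x * quat.Im1 y"
  "quat.Im3 (x * y) = quat.Re x * quat.Im3 y + quat.Im1 x * quat.Im2 y - quat.Im2 x * quat.Im1 y + quat.Im3 x * quat.Re y"
  by (simp_all add: one_quat_def times_quat_def)

lemma quat_of_real_simps [simp]:
  "quat.Re (of_real r) = r" "quat.Im1 (of_real r) = 0"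
  "quat.Im2 (of_real r) = 0" "quat.Im3 (of_real r) = 0"
  by (simp_all add: of_real_def)

instantiation quat :: real_inner
begin

definition "inner x y = quat.Re x * quat.Re y + quat.Im1 x * quat.Im1 y
  + quat.Im2 x * quat.Im2 y + quat.Im3 x * quat.Im3 y"
definition "norm (x::quat) = sqrt (inner x x)"
definition "sgn (x::quat) = x /\<^sub>R norm x"
definition "dist x y = norm (x - y :: quat)"
definition [code del]:
  "(uniformity :: (quat \<times> quat) filter) = (INF e\<in>{0 <..}. principal {(x, y). dist x y < e})"
definition [code del]:
  "open (U :: quat set) \<longleftrightarrow>
     (\<forall>x\<in>U. \<forall>\<^sub>F (x', y) in uniformity. x' = x \<longrightarrow> y \<in> U)"

instance
proof
  fix x y z :: quat and r :: real and U :: "quat set"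
  show "dist x y = norm (x - y)" "sgn x = x /\<^sub>R norm x" "norm x = sqrt (inner x x)"
    by (simp_all add: dist_quat_def sgn_quat_def norm_quat_def)
  show "uniformity = (INF e\<in>{0 <..}. principal {(x, y :: quat). dist x y < e})"
    by (rule uniformity_quat_def)
  show "open U \<longleftrightarrow> (\<forall>x\<in>U. \<forall>\<^sub>F (x', y) in uniformity. x' = x \<longrightarrow> y \<in> U)"
    by (rule open_quat_def)
  show "inner x y = inner y x" "inner (x + y) z = inner x z + inner y z"
    "inner (scaleR r x) y = r * inner x y" "0 \<le> inner x x"
    by (simp_all add: inner_quat_def algebra_simps)
  have "inner x x = (quat.Re x)\<^sup>2 + (quat.Im1 x)\<^sup>2 + ((quat.Im2 x)\<^sup>2 + (quat.Im3 x)\<^sup>2)"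
    by (simp add: inner_quat_def power2_eq_square)
  then show "inner x x = 0 \<longleftrightarrow> x = 0"
    by (simp add: quat_eq_iff add_nonneg_eq_0_iff)
qed

end

instance quat :: real_normed_algebra_1
proof
  fix x y :: quat
  have "inner (x * y) (x * y) = inner x x * inner y y"
    by (simp add: inner_quat_def algebra_simps)
  then have "norm (x * y) = norm x * norm y"
    by (simp add: norm_quat_def real_sqrt_mult)
  then show "norm (x * y) \<le> norm x * norm y"
    by simp
  show "norm (1::quat) = 1"
    by (simp add: norm_quat_def inner_quat_def)
qed

instantiation quat :: euclidean_space
begin

definition "Basis = {Quat 1 0 0 0, Quat 0 1 0 0, Quat 0 0 1 0, Quat 0 0 0 1}"

instance
proof
  fix x u v :: quat
  show "(Basis :: quat set) \<noteq> {}" "finite (Basis :: quat set)"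
    by (simp_all add: Basis_quat_def)
  show "(\<forall>u\<in>Basis. inner x u = 0) \<longleftrightarrow> x = 0"
    by (cases x) (auto simp add: Basis_quat_def inner_quat_def zero_quat_def)
  assume "u \<in> Basis" "v \<in> Basis"
  then show "inner u v = (if u = v then 1 else 0)"
    unfolding Basis_quat_def inner_quat_def by (elim insertE emptyE) simp_all
qed

end

definition quat_cnj :: "quat \<Rightarrow> quat" where
  "quat_cnj q = Quat (quat.Re q) (- quat.Im1 q) (- quat.Im2 q) (- quat.Im3 q)"

definition imag_units :: "quat set" where
  "imag_units = {q. q\<^sup>2 = - 1}"

lemma quat_cnj_mult_self: "quat_cnj q * q = of_real ((norm q)\<^sup>2)"
proof -
  have "(norm q)\<^sup>2 = inner q q"
    by (simp add: power2_norm_eq_inner)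
  then show ?thesis
    unfolding quat_eq_iff by (simp add: quat_cnj_def inner_quat_def)
qed

section \<open>Square integrable quaternion-valued functions\<close>

text \<open>Elements of \<open>L\<^sup>2\<close> are given by representatives: Lebesgue measurable functions,
  not classes modulo almost everywhere equality.\<close>

definition L2 :: "('a::euclidean_space \<Rightarrow> quat) set" where
  "L2 = {F \<in> borel_measurable lebesgue. integrable lebesgue (\<lambda>x. (norm (F x))\<^sup>2)}"

definition L2_inner :: "('a::euclidean_space \<Rightarrow> quat) \<Rightarrow> ('a \<Rightarrow> quat) \<Rightarrow> quat" where
  "L2_inner F G = (LINT x|lebesgue. quat_cnj (G x) * F x)"

text \<open>By \<open>quat_cnj_mult_self\<close>, \<open>L2_inner F F\<close> is a nonnegative real, so taking the
  real part only changes the type.\<close>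

definition L2_norm :: "('a::euclidean_space \<Rightarrow> quat) \<Rightarrow> real" where
  "L2_norm F = sqrt (quat.Re (L2_inner F F))"

section \<open>The Segal--Bargmann transform and the short-time Fourier transform\<close>

text \<open>The parameter is \<open>\<nu> = 2\<pi>\<close>. The kernel multiplies the quaternion \<open>f t\<close> from the left.\<close>

definition segal_bargmann :: "(real \<Rightarrow> quat) \<Rightarrow> quat \<Rightarrow> quat" where
  "segal_bargmann f q =
     (LINT t|lebesgue. of_real (2 powr (3/4))
        * exp (- (of_real pi * (q\<^sup>2 + of_real (t\<^sup>2))) + of_real (2 * pi * sqrt 2) * q * of_real t)
        * f t)"

text \<open>The window is the Gaussian \<open>\<phi>(t) = 2\<^bsup>1/4\<^esup> exp (-\<pi> t\<^sup>2)\<close>; it has no explicit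
  occurrence because the transform is defined through the Segal--Bargmann transform.\<close>

definition qstft_gauss :: "quat \<Rightarrow> (real \<Rightarrow> quat) \<Rightarrow> real \<times> real \<Rightarrow> quat" where
  "qstft_gauss I f = (\<lambda>(x, \<omega>).
     let q = of_real x + I * of_real \<omega>
     in exp (- (I * of_real (pi * x * \<omega>)))
        * segal_bargmann f (quat_cnj q /\<^sub>R sqrt 2)
        * of_real (exp (- (pi * (norm q)\<^sup>2 / 2))))"

end

(* After the two Gaussian factors are absorbed, the transform at (x, omega) is 2^(3/4) times the
   I-Fourier transform of the windowed function t |-> exp (-pi (x - t)^2) f t, at frequency omega.
   For fixed x, Plancherel evaluates the integral over omega, and Tonelli together with
   int exp (-2 pi (x - t)^2) dx = 1 / sqrt 2 evaluates the integral over x.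
   Plancherel itself is obtained by damping with exp (-pi c omega^2): the damped square norm is a
   Gaussian average of the autocorrelation of the function, and c --> 0 recovers the autocorrelation
   at 0, because translation is continuous in the square mean. *)

theory Submission
  imports Defs "HOL-Probability.Characteristic_Functions"
begin

section \<open>Rotations generated by an imaginary unit\<close>

text \<open>The values of \<open>f\<close> need not commute with \<open>I\<close>, so the complex
  Plancherel identity does not apply to them as they stand. Instead of splitting the values into two
  complex components, the proof treats the quaternions as a four-dimensional real inner product
  space. There left multiplication by \<open>I\<close> is a skew isometry, so rotations applied from
  the left behave like phases. The window makes the function at each fixed x both integrable and
  square integrable. Its Fourier integral therefore converges absolutely at every frequency, and the
  double integrals behind the autocorrelation can be interchanged. Square integrability of the
  transform is itself part of the conclusion, so Plancherel and the integration over the plane are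
  carried out with extended nonnegative integrals. The constant: squaring 2^(3/4) gives 2 sqrt 2,
  the squared window contributes 1 / sqrt 2, and the product 2 has root sqrt 2.\<close>

lemma imag_unitsD:
  assumes "I \<in> imag_units"
  shows "quat.Re I = 0" "I * I = - 1" "norm I = 1"
proof -
  have sq: "I * I = - 1"
    using assms by (simp add: imag_units_def power2_eq_square)
  then have eqs: "quat.Re I * quat.Re I - quat.Im1 I * quat.Im1 I - quat.Im2 I * quat.Im2 I
      - quat.Im3 I * quat.Im3 I = - 1"
    "quat.Re I * quat.Im1 I = 0" "quat.Re I * quat.Im2 I = 0" "quat.Re I * quat.Im3 I = 0"
    by (auto simp: quat_eq_iff)
  show re: "quat.Re I = 0"
  proof (rule ccontr)
    \<comment> \<open>A nonzero real part would kill all three imaginary parts, leaving a real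
      number with square -1.\<close>
    assume "quat.Re I \<noteq> 0"
    with eqs have "quat.Re I * quat.Re I = - 1"
      by simp
    then show False
      by (metis neg_0_le_iff_le not_one_le_zero zero_le_square)
  qed
  show "I * I = - 1"
    by fact
  show "norm I = 1"
    using eqs(1) re by (simp add: norm_quat_def inner_quat_def)
qed

lemma of_real_mult_mult: "of_real c * q * of_real t = (c * t) *\<^sub>R (q :: quat)"
  by (simp add: quat_eq_iff)

text \<open>This is exp (-I theta) in Euler form, with the minus sign of the Fourier kernel. The
  closed form gives measurability and inner products by plain algebra.\<close>

definition rot :: "quat \<Rightarrow> real \<Rightarrow> quat" where
  "rot I \<theta> = of_real (cos \<theta>) - I * of_real (sin \<theta>)"

lemma rot_mult: "rot I \<theta> * q = cos \<theta> *\<^sub>R q - sin \<theta> *\<^sub>R (I * q)"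
  by (simp add: rot_def quat_eq_iff algebra_simps)

lemma measurable_rot [measurable]: "rot I \<in> borel_measurable borel"
  unfolding rot_def[abs_def] by measurable

lemma rot_add:
  assumes "I * I = - 1"
  shows "rot I a * rot I b = rot I (a + b)"
proof -
  have *: "I * (I * q) = - q" for q
    using assms by (metis mult.assoc mult_minus1)
  show ?thesis
    unfolding rot_mult by (simp add: rot_def cos_add sin_add of_real_def algebra_simps * assms)
qed

lemma exp_eq_rot:
  assumes "I * I = - 1"
  shows "exp (- (I * of_real \<theta>)) = rot I \<theta>"
proof -
  \<comment> \<open>The exponential times the inverse rotation has derivative zero, hence is
    constantly 1. Since \<open>rot I \<theta>\<close> is a right inverse of the second factor,
    associativity then identifies it with the exponential.\<close>
  define g where "g t = exp (t *\<^sub>R (- I)) * (cos t *\<^sub>R 1 + sin t *\<^sub>R I)" for t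
  have "(g has_vector_derivative 0) (at t)" for t
  proof -
    have eq: "exp (t *\<^sub>R (- I)) * ((- sin t) *\<^sub>R 1 + cos t *\<^sub>R I)
        + exp (t *\<^sub>R (- I)) * (- I) * (cos t *\<^sub>R 1 + sin t *\<^sub>R I) = 0"
      by (simp add: algebra_simps mult.assoc assms)
    have "(g has_vector_derivative (exp (t *\<^sub>R (- I)) * ((- sin t) *\<^sub>R 1 + cos t *\<^sub>R I)
        + exp (t *\<^sub>R (- I)) * (- I) * (cos t *\<^sub>R 1 + sin t *\<^sub>R I))) (at t)"
      unfolding g_def
      by (rule has_vector_derivative_mult[OF exp_scaleR_has_vector_derivative_right])
        (auto intro!: derivative_eq_intros)
    then show ?thesis
      unfolding eq .
  qed
  then obtain c where c: "\<And>t. g t = c"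
    using has_vector_derivative_zero_constant[of UNIV g] by auto
  have "g \<theta> = 1"
    using c[of \<theta>] c[of 0] by (simp add: g_def)
  then have g1: "exp (- (I * of_real \<theta>)) * (cos \<theta> *\<^sub>R 1 + sin \<theta> *\<^sub>R I) = 1"
    by (simp add: g_def of_real_def)
  have *: "I * (I * q) = - q" for q
    using assms by (metis mult.assoc mult_minus1)
  have "(cos \<theta>)\<^sup>2 *\<^sub>R (1::quat) + (sin \<theta>)\<^sup>2 *\<^sub>R 1 = 1"
    by (simp flip: scaleR_left_distrib)
  then have "(cos \<theta> *\<^sub>R 1 + sin \<theta> *\<^sub>R I) * rot I \<theta> = 1"
    by (simp add: rot_def of_real_def algebra_simps assms * power2_eq_square)
  then show ?thesis
    using g1 by (metis mult.assoc mult_1 mult_1_right)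
qed

text \<open>Left multiplication by \<open>I\<close> preserves the inner product and is skew for it,
  so only the difference of the angles survives. The sine term is the price of real inner products;
  it is odd in \<open>a - b\<close>, which later makes it integrate to zero.\<close>

lemma inner_rot:
  assumes "I \<in> imag_units"
  shows "inner (rot I a * x) (rot I b * y) = cos (a - b) * inner x y + sin (a - b) * inner x (I * y)"
proof -
  note I = imag_unitsD[OF assms]
  have "(norm I)\<^sup>2 = 1"
    using I by simp
  then have n: "quat.Im1 I * quat.Im1 I + quat.Im2 I * quat.Im2 I + quat.Im3 I * quat.Im3 I = 1"
    using I(1) by (simp add: power2_norm_eq_inner inner_quat_def)
  have "inner (I * x) (I * y) = (quat.Im1 I * quat.Im1 I + quat.Im2 I * quat.Im2 I
      + quat.Im3 I * quat.Im3 I) * inner x y"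
    using I(1) by (simp add: inner_quat_def algebra_simps)
  then have "inner (I * x) (I * y) = inner x y"
    by (simp add: n)
  moreover have "inner (I * x) y = - inner x (I * y)"
    using I(1) by (simp add: inner_quat_def algebra_simps)
  ultimately show ?thesis
    by (simp add: rot_mult inner_diff_left inner_diff_right cos_diff sin_diff algebra_simps)
qed

lemma norm_rot_mult:
  assumes "I \<in> imag_units"
  shows "norm (rot I a * x) = norm x"
  using inner_rot[OF assms, of a x a x] by (simp add: norm_eq_sqrt_inner)

text \<open>The conjugate of x + I omega is x - I omega because \<open>I\<close> has real part 0, so
  the whole exponent lies in the commutative plane spanned by 1 and \<open>I\<close>. Its real part
  gives the scalar factor and its \<open>I\<close>-part the rotation. The phase pi x omega comes
  from the square of the argument; it is what the prefactor of the transform cancels.\<close>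

lemma segal_bargmann_kernel:
  assumes "I \<in> imag_units"
  defines "q \<equiv> \<lambda>x \<omega>. quat_cnj (of_real x + I * of_real \<omega>) /\<^sub>R sqrt 2"
  shows "exp (- (of_real pi * ((q x \<omega>)\<^sup>2 + of_real (t\<^sup>2))) + of_real (2 * pi * sqrt 2) * q x \<omega> * of_real t)
    = exp (- (pi * ((x\<^sup>2 - \<omega>\<^sup>2) / 2 + t\<^sup>2)) + 2 * pi * x * t)
        *\<^sub>R rot I (2 * pi * \<omega> * t - pi * x * \<omega>)"
proof -
  note I = imag_unitsD[OF assms(1)]
  define a where "a = - (pi * ((x\<^sup>2 - \<omega>\<^sup>2) / 2 + t\<^sup>2)) + 2 * pi * x * t"
  define b where "b = 2 * pi * \<omega> * t - pi * x * \<omega>"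
  have q: "q x \<omega> = (1 / sqrt 2) *\<^sub>R (x *\<^sub>R 1 - \<omega> *\<^sub>R I)"
    using I(1) by (simp add: q_def quat_eq_iff quat_cnj_def divide_inverse)
  have q2: "(q x \<omega>)\<^sup>2 = ((x\<^sup>2 - \<omega>\<^sup>2) / 2) *\<^sub>R 1 - (x * \<omega>) *\<^sub>R I"
  proof -
    have "(q x \<omega>)\<^sup>2 = (1 / 2) *\<^sub>R ((x *\<^sub>R 1 - \<omega> *\<^sub>R I) * (x *\<^sub>R 1 - \<omega> *\<^sub>R I))"
      by (simp add: q power2_eq_square)
    also have "\<dots> = ((x\<^sup>2 - \<omega>\<^sup>2) / 2) *\<^sub>R 1 - (x * \<omega>) *\<^sub>R I"
      using I(1) by (simp add: algebra_simps I(2) power2_eq_square) (simp add: quat_eq_iff field_simps)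
    finally show ?thesis .
  qed
  have lin: "of_real (2 * pi * sqrt 2) * q x \<omega> * of_real t = (2 * pi * t) *\<^sub>R (x *\<^sub>R 1 - \<omega> *\<^sub>R I)"
    unfolding q of_real_mult_mult by simp
  have "- (of_real pi * ((q x \<omega>)\<^sup>2 + of_real (t\<^sup>2))) + of_real (2 * pi * sqrt 2) * q x \<omega> * of_real t
      = of_real a + - (I * of_real b)"
  proof -
    have *: "of_real r * z = r *\<^sub>R z" "z * of_real r = r *\<^sub>R z" "of_real r = r *\<^sub>R (1 :: quat)"
      for r and z :: quat
      by (simp_all add: quat_eq_iff)
    show ?thesis
      unfolding q2 lin unfolding * by (simp add: quat_eq_iff I(1)) (simp add: a_def b_def algebra_simps diff_divide_distrib)
  qed
  moreover have "exp (of_real a + - (I * of_real b)) = exp (of_real a) * exp (- (I * of_real b))"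
    by (rule exp_add_commuting) (simp add: quat_eq_iff)
  moreover have "exp (of_real a :: quat) = of_real (exp a)"
    by (simp add: exp_of_real)
  ultimately show ?thesis
    unfolding a_def[symmetric] b_def[symmetric]
    by (simp only: exp_eq_rot[OF I(2)] scaleR_conv_of_real)
qed

section \<open>Continuity of translation in the square mean\<close>

lemma norm_add_sq_le: "(norm (a + b))\<^sup>2 \<le> 2 * (norm a)\<^sup>2 + 2 * (norm (b :: 'a :: real_normed_vector))\<^sup>2"
proof -
  have "(norm (a + b))\<^sup>2 \<le> (norm a + norm b)\<^sup>2"
    by (simp add: norm_triangle_ineq power_mono)
  also have "\<dots> \<le> 2 * (norm a)\<^sup>2 + 2 * (norm b)\<^sup>2"
    using zero_le_power2[of "norm a - norm b"] by (simp add: power2_eq_square algebra_simps)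
  finally show ?thesis .
qed

lemma integrable_norm_add_sq:
  fixes f g :: "'a \<Rightarrow> 'b :: euclidean_space"
  assumes [measurable]: "f \<in> borel_measurable M" "g \<in> borel_measurable M"
    and "integrable M (\<lambda>x. (norm (f x))\<^sup>2)" "integrable M (\<lambda>x. (norm (g x))\<^sup>2)"
  shows "integrable M (\<lambda>x. (norm (f x + g x))\<^sup>2)"
  by (rule Bochner_Integration.integrable_bound[of _ "\<lambda>x. 2 * (norm (f x))\<^sup>2 + 2 * (norm (g x))\<^sup>2"])
    (use assms norm_add_sq_le in \<open>auto intro!: Bochner_Integration.integrable_add\<close>)

lemma integrable_norm_diff_sq:
  fixes f g :: "'a \<Rightarrow> 'b :: euclidean_space"
  assumes [measurable]: "f \<in> borel_measurable M" "g \<in> borel_measurable M"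
    and "integrable M (\<lambda>x. (norm (f x))\<^sup>2)" "integrable M (\<lambda>x. (norm (g x))\<^sup>2)"
  shows "integrable M (\<lambda>x. (norm (f x - g x))\<^sup>2)"
  using integrable_norm_add_sq[of f M "\<lambda>x. - g x"] assms by simp

text \<open>A substitute for Minkowski's inequality without square roots. The factors 2 are harmless
  because it is applied to make errors small and to get a crude bound.\<close>

lemma integral_norm_add_sq_le:
  fixes f g :: "'a \<Rightarrow> 'b :: euclidean_space"
  assumes [measurable]: "f \<in> borel_measurable M" "g \<in> borel_measurable M"
    and "integrable M (\<lambda>x. (norm (f x))\<^sup>2)" "integrable M (\<lambda>x. (norm (g x))\<^sup>2)"
  shows "(\<integral>x. (norm (f x + g x))\<^sup>2 \<partial>M)
    \<le> 2 * (\<integral>x. (norm (f x))\<^sup>2 \<partial>M) + 2 * (\<integral>x. (norm (g x))\<^sup>2 \<partial>M)"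
proof -
  have "(\<integral>x. (norm (f x + g x))\<^sup>2 \<partial>M) \<le> (\<integral>x. 2 * (norm (f x))\<^sup>2 + 2 * (norm (g x))\<^sup>2 \<partial>M)"
    by (intro integral_mono integrable_norm_add_sq norm_add_sq_le)
      (use assms in \<open>auto intro!: Bochner_Integration.integrable_add\<close>)
  also have "\<dots> = 2 * (\<integral>x. (norm (f x))\<^sup>2 \<partial>M) + 2 * (\<integral>x. (norm (g x))\<^sup>2 \<partial>M)"
    using assms by simp
  finally show ?thesis .
qed

lemma abs_inner_le_sq: "\<bar>inner a b\<bar> \<le> (norm a)\<^sup>2 + (norm b)\<^sup>2" for a b :: "'a :: real_inner"
proof -
  have "\<bar>inner a b\<bar> \<le> norm a * norm b"
    by (rule Cauchy_Schwarz_ineq2)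
  also have "\<dots> \<le> (norm a)\<^sup>2 + (norm b)\<^sup>2"
    using sum_squares_bound[of "norm a" "norm b"] mult_nonneg_nonneg[OF norm_ge_zero norm_ge_zero, of a b]
    by (simp only: mult.assoc)
  finally show ?thesis .
qed

lemma integrable_inner_of_sq:
  fixes f g :: "'a \<Rightarrow> 'b :: euclidean_space"
  assumes [measurable]: "f \<in> borel_measurable M" "g \<in> borel_measurable M"
    and "integrable M (\<lambda>x. (norm (f x))\<^sup>2)" "integrable M (\<lambda>x. (norm (g x))\<^sup>2)"
  shows "integrable M (\<lambda>x. inner (f x) (g x))"
proof (rule Bochner_Integration.integrable_bound[of _ "\<lambda>x. (norm (f x))\<^sup>2 + (norm (g x))\<^sup>2"])
  show "AE x in M. norm (inner (f x) (g x)) \<le> norm ((norm (f x))\<^sup>2 + (norm (g x))\<^sup>2)"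
    by (intro AE_I2) (simp add: abs_inner_le_sq)
qed (use assms in auto)

text \<open>The radial projection onto the closed ball of radius \<open>r\<close>. With
  \<open>max\<close> in the denominator it is one continuous formula for positive
  \<open>r\<close>.\<close>

definition clip :: "real \<Rightarrow> 'b \<Rightarrow> 'b :: real_normed_vector" where
  "clip r y = (r / max r (norm y)) *\<^sub>R y"

lemma norm_clip_le: "0 < r \<Longrightarrow> norm (clip r y) \<le> r" "0 < r \<Longrightarrow> norm (clip r y) \<le> norm y"
  by (auto simp: clip_def field_simps max_def)

lemma clip_eq: "0 < r \<Longrightarrow> norm y \<le> r \<Longrightarrow> clip r y = y"
  by (simp add: clip_def max_def)

lemma continuous_on_clip [continuous_intros]:
  "0 < r \<Longrightarrow> continuous_on S f \<Longrightarrow> continuous_on S (\<lambda>x. clip r (f x))"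
  unfolding clip_def by (intro continuous_intros) auto

lemma tendsto_clip: "0 < r \<Longrightarrow> (f \<longlongrightarrow> l) F \<Longrightarrow> ((\<lambda>x. clip r (f x)) \<longlongrightarrow> clip r l) F"
  unfolding clip_def by (intro tendsto_intros) auto

text \<open>A trapezoid: 1 on [-r, r], falling linearly to 0 over the next unit length on either
  side.\<close>

definition cutoff :: "real \<Rightarrow> real \<Rightarrow> real" where
  "cutoff r t = max 0 (min 1 (r + 1 - \<bar>t\<bar>))"

lemma cutoff_bounds: "0 \<le> cutoff r t" "cutoff r t \<le> 1" "\<bar>t\<bar> > r + 1 \<Longrightarrow> cutoff r t = 0"
  "\<bar>t\<bar> \<le> r \<Longrightarrow> cutoff r t = 1"
  by (auto simp: cutoff_def)

lemma continuous_on_cutoff [continuous_intros]: "continuous_on S (cutoff r)"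
  unfolding cutoff_def by (intro continuous_intros)

text \<open>A measurable function is an almost everywhere limit of continuous functions; clipping and
  cutting off these approximants makes dominated convergence applicable.\<close>

lemma L2_approx_continuous_compact_support:
  fixes f :: "real \<Rightarrow> 'b::euclidean_space"
  assumes f [measurable]: "f \<in> borel_measurable borel"
    and f2: "integrable lborel (\<lambda>t. (norm (f t))\<^sup>2)" and e: "0 < e"
  obtains g R where "continuous_on UNIV g" "\<And>t. \<bar>t\<bar> > R \<Longrightarrow> g t = 0"
    "\<And>t. norm (g t) \<le> R" "(\<integral>t. (norm (f t - g t))\<^sup>2 \<partial>lborel) < e"
proof -
  have "f \<in> borel_measurable lebesgue"
    by (simp add: measurable_completion)
  then have "f measurable_on UNIV"
    by (rule lebesgue_measurable_imp_measurable_on) simp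
  then obtain N g where N: "negligible N" and g: "\<And>n. continuous_on UNIV (g n)"
    and lim: "\<And>x. x \<notin> N \<Longrightarrow> (\<lambda>n. g n x) \<longlonglongrightarrow> f x"
    unfolding measurable_on_def by auto
  have g_meas [measurable]: "g n \<in> borel_measurable borel" for n
    by (rule borel_measurable_continuous_onI) (rule g)
  have "AE x in lebesgue. x \<notin> N"
    using N by (intro AE_not_in) (simp add: negligible_iff_null_sets)
  then have ae: "AE x in lborel. (\<lambda>n. g n x) \<longlonglongrightarrow> f x"
    unfolding AE_completion_iff using lim by (auto elim!: eventually_mono)
  have [measurable]: "cutoff r \<in> borel_measurable borel" for r
    by (rule borel_measurable_continuous_onI) (rule continuous_on_cutoff)
  have [measurable]: "(clip r :: 'b \<Rightarrow> 'b) \<in> borel_measurable borel" if "0 < r" for r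
    using that by (intro borel_measurable_continuous_onI continuous_intros)
  \<comment> \<open>The continuous approximants \<open>g n\<close> converge only pointwise, with no
    common square integrable bound. So \<open>f\<close> is first replaced by a truncation
    \<open>F r\<close> at a fixed level, and then \<open>F r\<close> by the same truncation of
    \<open>g n\<close>; both are bounded by \<open>r\<close> on a fixed interval.\<close>
  define F where "F r t = cutoff r t *\<^sub>R clip r (f t)" for r t
  have F_meas [measurable]: "F r \<in> borel_measurable borel" if "0 < r" for r
    using that unfolding F_def by measurable
  have F_le: "norm (F r t) \<le> norm (f t)" if "0 < r" for r t
    using that cutoff_bounds[of r t] norm_clip_le(2)[of r "f t"]
    by (simp add: F_def mult_left_le_one_le order_trans[OF mult_left_le_one_le])
  have F2: "integrable lborel (\<lambda>t. (norm (F r t))\<^sup>2)" if "0 < r" for r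
    by (rule Bochner_Integration.integrable_bound[OF f2]) (use that F_le in \<open>auto intro!: power_mono\<close>)
  have "(\<lambda>n. \<integral>t. (norm (f t - F (real (Suc n)) t))\<^sup>2 \<partial>lborel) \<longlonglongrightarrow> (\<integral>t. 0 \<partial>(lborel :: real measure))"
  proof (rule integral_dominated_convergence[where w = "\<lambda>t. 4 * (norm (f t))\<^sup>2"])
    show "integrable lborel (\<lambda>t. 4 * (norm (f t))\<^sup>2)"
      using f2 by simp
    show "AE t in lborel. (\<lambda>n. (norm (f t - F (real (Suc n)) t))\<^sup>2) \<longlonglongrightarrow> 0"
    proof (rule AE_I2)
      fix t
      have "eventually (\<lambda>n. real n \<ge> max \<bar>t\<bar> (norm (f t))) sequentially"
        by (rule filterlim_at_top[THEN iffD1, rule_format, OF filterlim_real_sequentially])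
      \<comment> \<open>Once the level exceeds both the modulus of t and the norm of the value,
        neither truncation acts at t.\<close>
      then have "eventually (\<lambda>n. (norm (f t - F (real (Suc n)) t))\<^sup>2 = 0) sequentially"
        by eventually_elim (auto simp: F_def cutoff_bounds clip_eq)
      then show "(\<lambda>n. (norm (f t - F (real (Suc n)) t))\<^sup>2) \<longlonglongrightarrow> 0"
        by (rule tendsto_eventually)
    qed
    show "AE t in lborel. norm ((norm (f t - F (real (Suc n)) t))\<^sup>2) \<le> 4 * (norm (f t))\<^sup>2" for n
    proof (rule AE_I2)
      fix t
      have "norm (f t - F (real (Suc n)) t) \<le> norm (f t) + norm (F (real (Suc n)) t)"
        by (rule norm_triangle_ineq4)
      also have "\<dots> \<le> 2 * norm (f t)"
        using F_le[of "real (Suc n)" t] by simp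
      finally have "(norm (f t - F (real (Suc n)) t))\<^sup>2 \<le> (2 * norm (f t))\<^sup>2"
        by (rule power_mono) simp
      then show "norm ((norm (f t - F (real (Suc n)) t))\<^sup>2) \<le> 4 * (norm (f t))\<^sup>2"
        by (simp add: power_mult_distrib)
    qed
  qed auto
  \<comment> \<open>Each of the two errors is doubled by \<open>integral_norm_add_sq_le\<close>,
    hence the bound e / 4.\<close>
  then have "eventually (\<lambda>n. (\<integral>t. (norm (f t - F (real (Suc n)) t))\<^sup>2 \<partial>lborel) < e / 4) sequentially"
    using e by (intro order_tendstoD(2)[where y = 0]) auto
  then obtain n0 where n0: "(\<integral>t. (norm (f t - F (real (Suc n0)) t))\<^sup>2 \<partial>lborel) < e / 4"
    by (auto dest: eventually_happens)
  define r where "r = real (Suc n0)"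
  have r: "0 < r"
    by (simp add: r_def)
  define G where "G n t = cutoff r t *\<^sub>R clip r (g n t)" for n t
  have G_meas [measurable]: "G n \<in> borel_measurable borel" for n
    using r unfolding G_def by measurable
  have bnd: "norm (cutoff r t *\<^sub>R clip r y) \<le> r * indicator {-(r+1)..r+1} t" for t and y :: 'b
    using cutoff_bounds[of r t] norm_clip_le(1)[OF r, of y] r
    by (cases "\<bar>t\<bar> \<le> r + 1") (auto simp: indicator_def intro: mult_left_le_one_le order_trans[OF mult_left_le_one_le])
  have ind: "integrable lborel (\<lambda>t. c * indicator {-(r+1)..r+1} t :: real)" for c
    by (intro integrable_mult_right integrable_real_indicator) (auto simp: emeasure_lborel_Icc_eq)
  have G2: "integrable lborel (\<lambda>t. (norm (G n t))\<^sup>2)" for n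
  proof (rule Bochner_Integration.integrable_bound[OF ind[of "r\<^sup>2"]])
    show "AE t in lborel. norm ((norm (G n t))\<^sup>2) \<le> norm (r\<^sup>2 * indicator {-(r+1)..r+1} t)"
    proof (rule AE_I2)
      fix t
      show "norm ((norm (G n t))\<^sup>2) \<le> norm (r\<^sup>2 * indicator {-(r+1)..r+1} t)"
        using power_mono[OF bnd[of t "g n t"], of 2]
        by (cases "t \<in> {-(r+1)..r+1}") (simp_all only: G_def indicator_simps, simp_all)
    qed
  qed auto
  have "(\<lambda>n. \<integral>t. (norm (F r t - G n t))\<^sup>2 \<partial>lborel) \<longlonglongrightarrow> (\<integral>t. 0 \<partial>(lborel :: real measure))"
  proof (rule integral_dominated_convergence[where w = "\<lambda>t. (2 * r)\<^sup>2 * indicator {-(r+1)..r+1} t", OF _ _ ind])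
    show "AE t in lborel. (\<lambda>n. (norm (F r t - G n t))\<^sup>2) \<longlonglongrightarrow> 0"
      using ae
    proof eventually_elim
      case (elim t)
      then have "(\<lambda>n. (norm (F r t - G n t))\<^sup>2) \<longlonglongrightarrow> (norm (F r t - F r t))\<^sup>2"
        unfolding G_def F_def by (intro tendsto_intros tendsto_clip r)
      then show ?case
        by simp
    qed
    show "AE t in lborel. norm ((norm (F r t - G n t))\<^sup>2) \<le> (2 * r)\<^sup>2 * indicator {-(r+1)..r+1} t" for n
    proof (rule AE_I2)
      fix t
      have "norm (F r t - G n t) \<le> norm (F r t) + norm (G n t)"
        by (rule norm_triangle_ineq4)
      also have "\<dots> \<le> 2 * r * indicator {-(r+1)..r+1} t"
        using bnd[of t "f t"] bnd[of t "g n t"] by (simp add: F_def G_def)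
      finally show "norm ((norm (F r t - G n t))\<^sup>2) \<le> (2 * r)\<^sup>2 * indicator {-(r+1)..r+1} t"
        using power_mono[of "norm (F r t - G n t)" "2 * r * indicator {-(r+1)..r+1} t" 2]
        by (cases "t \<in> {-(r+1)..r+1}") (simp_all only: indicator_simps, simp_all)
    qed
  qed (use r in auto)
  then have "eventually (\<lambda>n. (\<integral>t. (norm (F r t - G n t))\<^sup>2 \<partial>lborel) < e / 4) sequentially"
    using e by (intro order_tendstoD(2)[where y = 0]) auto
  then obtain n1 where n1: "(\<integral>t. (norm (F r t - G n1 t))\<^sup>2 \<partial>lborel) < e / 4"
    by (auto dest: eventually_happens)
  show thesis
  \<comment> \<open>One constant serves as radius of the support and as bound of the values; the
    support, widened by the slope of \<open>cutoff\<close>, forces \<open>r + 1\<close>.\<close>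
  proof (rule that[of "G n1" "r + 1"])
    show "continuous_on UNIV (G n1)"
      unfolding G_def using r g by (intro continuous_intros)
    show "G n1 t = 0" if "\<bar>t\<bar> > r + 1" for t
      using that by (simp add: G_def cutoff_bounds)
    show "norm (G n1 t) \<le> r + 1" for t
      using bnd[of t "g n1 t"] r
      by (cases "t \<in> {-(r+1)..r+1}") (simp_all only: G_def indicator_simps, simp_all)
    have "(\<integral>t. (norm ((f t - F r t) + (F r t - G n1 t)))\<^sup>2 \<partial>lborel)
        \<le> 2 * (\<integral>t. (norm (f t - F r t))\<^sup>2 \<partial>lborel) + 2 * (\<integral>t. (norm (F r t - G n1 t))\<^sup>2 \<partial>lborel)"
      using r by (intro integral_norm_add_sq_le integrable_norm_diff_sq f2 F2 G2) auto
    then show "(\<integral>t. (norm (f t - G n1 t))\<^sup>2 \<partial>lborel) < e"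
      using n0 n1 by (simp add: r_def)
  qed
qed

section \<open>Translation invariance and small translations\<close>

lemma integrable_translate:
  fixes f :: "real \<Rightarrow> 'b::euclidean_space"
  shows "integrable lborel f \<Longrightarrow> integrable lborel (\<lambda>t. f (t + u))"
  using lborel_integrable_real_affine[of f 1 u] by (simp add: add.commute)

lemma integral_translate:
  fixes f :: "real \<Rightarrow> 'b::euclidean_space"
  shows "(\<integral>t. f (t + u) \<partial>lborel) = (\<integral>t. f t \<partial>lborel)"
  using lborel_integral_real_affine[of 1 f u] by (simp add: add.commute)

text \<open>The difference is split through a continuous compactly supported \<open>g\<close>. By
  translation invariance the two errors between \<open>f\<close> and \<open>g\<close> are equal, and
  the shift of \<open>g\<close> itself is handled by dominated convergence.\<close>

lemma L2_translation_continuous: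
  fixes f :: "real \<Rightarrow> 'b::euclidean_space"
  assumes f [measurable]: "f \<in> borel_measurable borel"
    and f2: "integrable lborel (\<lambda>t. (norm (f t))\<^sup>2)" and X: "X \<longlonglongrightarrow> 0"
  shows "(\<lambda>n. \<integral>t. (norm (f (t + X n) - f t))\<^sup>2 \<partial>lborel) \<longlonglongrightarrow> 0"
proof (rule LIMSEQ_I)
  fix e :: real assume e: "0 < e"
  \<comment> \<open>Applying the sum estimate twice gives 6 times the approximation error plus 4
    times the shift error of \<open>g\<close>; with both below e / 12 the total is below e.\<close>
  obtain g R where g: "continuous_on UNIV g" and g0: "\<And>t. \<bar>t\<bar> > R \<Longrightarrow> g t = 0"
    and gR: "\<And>t. norm (g t) \<le> R" and fg: "(\<integral>t. (norm (f t - g t))\<^sup>2 \<partial>lborel) < e / 12"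
    using L2_approx_continuous_compact_support[OF f f2, of "e / 12"] e by auto
  have [measurable]: "g \<in> borel_measurable borel"
    by (rule borel_measurable_continuous_onI) (rule g)
  have R: "0 \<le> R"
    using gR[of 0] norm_ge_zero[of "g 0"] by linarith
  have ind: "integrable lborel (\<lambda>t. c * indicator {-r..r} t :: real)" for c r :: real
    by (intro integrable_mult_right integrable_real_indicator) (auto simp: emeasure_lborel_Icc_eq)
  have g2: "integrable lborel (\<lambda>t. (norm (g t))\<^sup>2)"
    by (rule Bochner_Integration.integrable_bound[OF ind[of "R\<^sup>2" R]])
      (use gR g0 R in \<open>auto simp: indicator_def intro!: power_mono\<close>)
  have "eventually (\<lambda>n. \<bar>X n\<bar> < 1) sequentially"
    using tendstoD[OF X, of 1] by simp
  then obtain N where N: "\<And>n. n \<ge> N \<Longrightarrow> \<bar>X n\<bar> < 1"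
    unfolding eventually_sequentially by auto
  \<comment> \<open>Dropping finitely many terms makes every shift smaller than 1, so all translates
    of \<open>g\<close> vanish outside one interval of radius \<open>R + 1\<close>.\<close>
  define Y where "Y n = X (n + N)" for n
  have Y: "Y \<longlonglongrightarrow> 0" and Y1: "\<bar>Y n\<bar> < 1" for n
    using LIMSEQ_ignore_initial_segment[OF X, of N] N by (simp_all add: Y_def[abs_def])
  have "(\<lambda>n. \<integral>t. (norm (g (t + Y n) - g t))\<^sup>2 \<partial>lborel) \<longlonglongrightarrow> (\<integral>t. 0 \<partial>(lborel :: real measure))"
  proof (rule integral_dominated_convergence[where w = "\<lambda>t. (2 * R)\<^sup>2 * indicator {-(R+1)..R+1} t", OF _ _ ind])
    show "AE t in lborel. (\<lambda>n. (norm (g (t + Y n) - g t))\<^sup>2) \<longlonglongrightarrow> 0"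
    proof (rule AE_I2)
      fix t
      have "isCont g t"
        using g by (simp add: continuous_on_eq_continuous_at)
      moreover have "(\<lambda>n. t + Y n) \<longlonglongrightarrow> t"
        using tendsto_add[OF tendsto_const Y, of t] by simp
      ultimately have "(\<lambda>n. g (t + Y n)) \<longlonglongrightarrow> g t"
        by (rule isCont_tendsto_compose)
      then have "(\<lambda>n. (norm (g (t + Y n) - g t))\<^sup>2) \<longlonglongrightarrow> (norm (g t - g t))\<^sup>2"
        by (intro tendsto_intros)
      then show "(\<lambda>n. (norm (g (t + Y n) - g t))\<^sup>2) \<longlonglongrightarrow> 0"
        by simp
    qed
    show "AE t in lborel. norm ((norm (g (t + Y n) - g t))\<^sup>2) \<le> (2 * R)\<^sup>2 * indicator {-(R+1)..R+1} t" for n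
    proof (rule AE_I2)
      fix t
      show "norm ((norm (g (t + Y n) - g t))\<^sup>2) \<le> (2 * R)\<^sup>2 * indicator {-(R+1)..R+1} t"
      proof (cases "\<bar>t\<bar> \<le> R + 1")
        case True
        have "norm (g (t + Y n) - g t) \<le> 2 * R"
          using norm_triangle_ineq4[of "g (t + Y n)" "g t"] gR[of t] gR[of "t + Y n"] by simp
        then have "(norm (g (t + Y n) - g t))\<^sup>2 \<le> (2 * R)\<^sup>2"
          by (rule power_mono) simp
        with True show ?thesis
          by (simp add: indicator_def abs_le_iff)
      next
        case False
        then have "g t = 0" "g (t + Y n) = 0"
          using Y1[of n] by (auto intro!: g0)
        then show ?thesis
          by simp
      qed
    qed
  qed auto
  then have "eventually (\<lambda>n. (\<integral>t. (norm (g (t + Y n) - g t))\<^sup>2 \<partial>lborel) < e / 12) sequentially"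
    using e by (intro order_tendstoD(2)[where y = 0]) auto
  then obtain M where M: "\<And>n. n \<ge> M \<Longrightarrow> (\<integral>t. (norm (g (t + Y n) - g t))\<^sup>2 \<partial>lborel) < e / 12"
    unfolding eventually_sequentially by auto
  show "\<exists>no. \<forall>n\<ge>no. norm ((\<integral>t. (norm (f (t + X n) - f t))\<^sup>2 \<partial>lborel) - 0) < e"
  proof (intro exI allI impI)
    fix n assume n: "n \<ge> M + N"
    have fg2: "integrable lborel (\<lambda>t. (norm (f t - g t))\<^sup>2)"
      by (intro integrable_norm_diff_sq f2 g2) auto
    have fg2': "integrable lborel (\<lambda>t. (norm (f (t + X n) - g (t + X n)))\<^sup>2)"
      using integrable_translate[OF fg2] by simp
    have gg2: "integrable lborel (\<lambda>t. (norm (g (t + X n) - g t))\<^sup>2)"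
      by (intro integrable_norm_diff_sq g2 integrable_translate) auto
    have gf2: "integrable lborel (\<lambda>t. (norm (g t - f t))\<^sup>2)"
      using fg2 by (simp add: norm_minus_commute)
    have "(\<integral>t. (norm ((f (t + X n) - g (t + X n)) + ((g (t + X n) - g t) + (g t - f t))))\<^sup>2 \<partial>lborel)
        \<le> 2 * (\<integral>t. (norm (f (t + X n) - g (t + X n)))\<^sup>2 \<partial>lborel)
          + 2 * (\<integral>t. (norm ((g (t + X n) - g t) + (g t - f t)))\<^sup>2 \<partial>lborel)"
      by (intro integral_norm_add_sq_le fg2' integrable_norm_add_sq gg2 gf2) auto
    also have "(\<integral>t. (norm ((g (t + X n) - g t) + (g t - f t)))\<^sup>2 \<partial>lborel)
        \<le> 2 * (\<integral>t. (norm (g (t + X n) - g t))\<^sup>2 \<partial>lborel) + 2 * (\<integral>t. (norm (g t - f t))\<^sup>2 \<partial>lborel)"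
      by (intro integral_norm_add_sq_le gg2 gf2) auto
    also have "(\<integral>t. (norm (f (t + X n) - g (t + X n)))\<^sup>2 \<partial>lborel) = (\<integral>t. (norm (f t - g t))\<^sup>2 \<partial>lborel)"
      by (rule integral_translate)
    also have "(\<integral>t. (norm (g t - f t))\<^sup>2 \<partial>lborel) = (\<integral>t. (norm (f t - g t))\<^sup>2 \<partial>lborel)"
      by (simp add: norm_minus_commute)
    finally have "(\<integral>t. (norm (f (t + X n) - f t))\<^sup>2 \<partial>lborel) < e"
      using e fg M[of "n - N"] le_diff_conv2[of N n M] n by (simp add: Y_def)
    then show "norm ((\<integral>t. (norm (f (t + X n) - f t))\<^sup>2 \<partial>lborel) - 0) < e"
      by simp
  qed
qed

section \<open>Autocorrelation near the zero shift\<close>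

lemma inner_eq_norm_diff_sq:
  "inner a b = ((norm a)\<^sup>2 + (norm b)\<^sup>2 - (norm (b - a))\<^sup>2) / 2" for a b :: "'a :: real_inner"
  by (simp add: power2_norm_eq_inner inner_diff inner_commute)

text \<open>Polarization, with the two square norms equal by translation invariance. It reduces both
  the bound and the continuity of the autocorrelation to the square mean of f (t + u) - f t.\<close>

lemma autocorrelation_eq:
  fixes f :: "real \<Rightarrow> 'b::euclidean_space"
  assumes f [measurable]: "f \<in> borel_measurable borel"
    and f2: "integrable lborel (\<lambda>t. (norm (f t))\<^sup>2)"
  shows "(\<integral>t. inner (f t) (f (t + u)) \<partial>lborel)
    = (\<integral>t. (norm (f t))\<^sup>2 \<partial>lborel) - (\<integral>t. (norm (f (t + u) - f t))\<^sup>2 \<partial>lborel) / 2"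
proof -
  have f2': "integrable lborel (\<lambda>t. (norm (f (t + u)))\<^sup>2)"
    using integrable_translate[OF f2] by simp
  have d: "integrable lborel (\<lambda>t. (norm (f (t + u) - f t))\<^sup>2)"
    by (intro integrable_norm_diff_sq f2 f2') auto
  have "(\<integral>t. inner (f t) (f (t + u)) \<partial>lborel)
      = (\<integral>t. ((norm (f t))\<^sup>2 + (norm (f (t + u)))\<^sup>2 - (norm (f (t + u) - f t))\<^sup>2) / 2 \<partial>lborel)"
    by (simp only: inner_eq_norm_diff_sq)
  also have "\<dots> = ((\<integral>t. (norm (f t))\<^sup>2 \<partial>lborel) + (\<integral>t. (norm (f (t + u)))\<^sup>2 \<partial>lborel)
      - (\<integral>t. (norm (f (t + u) - f t))\<^sup>2 \<partial>lborel)) / 2"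
    using f2 f2' d by simp
  also have "(\<integral>t. (norm (f (t + u)))\<^sup>2 \<partial>lborel) = (\<integral>t. (norm (f t))\<^sup>2 \<partial>lborel)"
    by (rule integral_translate)
  finally show ?thesis
    by (simp add: field_simps)
qed

text \<open>From above, a nonnegative term is subtracted; from below, that term is at most half of 4
  times the square norm. The bound is uniform in \<open>u\<close>, as dominated convergence
  requires.\<close>

lemma autocorrelation_abs_le:
  fixes f :: "real \<Rightarrow> 'b::euclidean_space"
  assumes f [measurable]: "f \<in> borel_measurable borel"
    and f2: "integrable lborel (\<lambda>t. (norm (f t))\<^sup>2)"
  shows "\<bar>\<integral>t. inner (f t) (f (t + u)) \<partial>lborel\<bar> \<le> (\<integral>t. (norm (f t))\<^sup>2 \<partial>lborel)"
proof -
  have f2': "integrable lborel (\<lambda>t. (norm (f (t + u)))\<^sup>2)"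
    using integrable_translate[OF f2] by simp
  have "(\<integral>t. (norm (f (t + u) + - f t))\<^sup>2 \<partial>lborel)
      \<le> 2 * (\<integral>t. (norm (f (t + u)))\<^sup>2 \<partial>lborel) + 2 * (\<integral>t. (norm (- f t))\<^sup>2 \<partial>lborel)"
    by (intro integral_norm_add_sq_le f2') (use f2 in auto)
  also have "(\<integral>t. (norm (f (t + u)))\<^sup>2 \<partial>lborel) = (\<integral>t. (norm (f t))\<^sup>2 \<partial>lborel)"
    by (rule integral_translate)
  finally show ?thesis
    unfolding autocorrelation_eq[OF f f2]
    using integral_nonneg_AE[of _ lborel, OF AE_I2, of "\<lambda>t. (norm (f (t + u) - f t))\<^sup>2"]
      integral_nonneg_AE[of _ lborel, OF AE_I2, of "\<lambda>t. (norm (f t))\<^sup>2"] by (simp add: abs_le_iff)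
qed

lemma autocorrelation_tendsto:
  fixes f :: "real \<Rightarrow> 'b::euclidean_space"
  assumes f: "f \<in> borel_measurable borel"
    and f2: "integrable lborel (\<lambda>t. (norm (f t))\<^sup>2)" and X: "X \<longlonglongrightarrow> 0"
  shows "(\<lambda>n. \<integral>t. inner (f t) (f (t + X n)) \<partial>lborel) \<longlonglongrightarrow> (\<integral>t. (norm (f t))\<^sup>2 \<partial>lborel)"
proof -
  have "(\<lambda>n. (\<integral>t. (norm (f t))\<^sup>2 \<partial>lborel) - (\<integral>t. (norm (f (t + X n) - f t))\<^sup>2 \<partial>lborel) / 2)
      \<longlonglongrightarrow> (\<integral>t. (norm (f t))\<^sup>2 \<partial>lborel) - 0 / 2"
    by (intro tendsto_diff tendsto_divide tendsto_const L2_translation_continuous assms) simp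
  then show ?thesis
    by (simp add: autocorrelation_eq[OF f f2])
qed

section \<open>Fourier integrals of Gaussians\<close>

text \<open>The real and imaginary parts of the characteristic function of the standard normal
  distribution, which is real.\<close>

lemma std_gauss_cos_sin:
  "integrable lborel (\<lambda>x. std_normal_density x * cos (t * x))"
  "integrable lborel (\<lambda>x. std_normal_density x * sin (t * x))"
  "(\<integral>x. std_normal_density x * cos (t * x) \<partial>lborel) = exp (- t\<^sup>2 / 2)"
  "(\<integral>x. std_normal_density x * sin (t * x) \<partial>lborel) = 0"
proof -
  have int: "integrable lborel (\<lambda>x. std_normal_density x *\<^sub>R iexp (t * x))"
    by (rule Bochner_Integration.integrable_bound[of _ "std_normal_density"])
      (auto intro!: integrable_normal_density simp: normal_density_nonneg)
  have "complex_of_real (exp (- t\<^sup>2 / 2)) = char std_normal_distribution t"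
    by (simp add: char_std_normal_distribution)
  also have "\<dots> = (\<integral>x. std_normal_density x *\<^sub>R iexp (t * x) \<partial>lborel)"
    by (simp add: char_def integral_density normal_density_nonneg)
  finally have eq: "(\<integral>x. std_normal_density x *\<^sub>R iexp (t * x) \<partial>lborel) = complex_of_real (exp (- t\<^sup>2 / 2))" ..
  have re: "Re (std_normal_density x *\<^sub>R iexp (t * x)) = std_normal_density x * cos (t * x)"
    and im: "Im (std_normal_density x *\<^sub>R iexp (t * x)) = std_normal_density x * sin (t * x)" for x
    by (simp_all add: Re_exp Im_exp)
  show "integrable lborel (\<lambda>x. std_normal_density x * cos (t * x))"
    using integrable_Re[OF int] by (simp only: re)
  show "integrable lborel (\<lambda>x. std_normal_density x * sin (t * x))"
    using integrable_Im[OF int] by (simp only: im)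
  show "(\<integral>x. std_normal_density x * cos (t * x) \<partial>lborel) = exp (- t\<^sup>2 / 2)"
    using integral_Re[OF int] by (simp only: re eq Re_complex_of_real)
  show "(\<integral>x. std_normal_density x * sin (t * x) \<partial>lborel) = 0"
    using integral_Im[OF int] by (simp only: im eq Im_complex_of_real)
qed

lemma gauss_cos_sin:
  assumes c: "0 < c"
  shows "integrable lborel (\<lambda>x. exp (- (pi * c * x\<^sup>2)) * cos (2 * pi * u * x))"
    and "integrable lborel (\<lambda>x. exp (- (pi * c * x\<^sup>2)) * sin (2 * pi * u * x))"
    and "(\<integral>x. exp (- (pi * c * x\<^sup>2)) * cos (2 * pi * u * x) \<partial>lborel) = exp (- (pi * u\<^sup>2 / c)) / sqrt c"
    and "(\<integral>x. exp (- (pi * c * x\<^sup>2)) * sin (2 * pi * u * x) \<partial>lborel) = 0"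
proof -
  \<comment> \<open>\<open>k\<close> is chosen so that k^2 / 2 = pi c, which turns the standard
    Gaussian into the damping factor, and \<open>t\<close> so that t k is the frequency 2 pi
    u.\<close>
  define k where "k = sqrt (2 * pi * c)"
  define t where "t = 2 * pi * u / k"
  have k: "0 < k" "k\<^sup>2 = 2 * pi * c"
    using c by (simp_all add: k_def)
  have tk: "t * (k * x) = 2 * pi * u * x" for x
    using k by (simp add: t_def)
  have tt: "t\<^sup>2 / 2 = pi * u\<^sup>2 / c"
    using c by (simp add: t_def power_divide k power_mult_distrib) (simp add: field_simps power2_eq_square)
  have dens: "std_normal_density (k * x) = exp (- (pi * c * x\<^sup>2)) / sqrt (2 * pi)" for x
    by (simp add: std_normal_density_def power_mult_distrib k)
  have aff: "integrable lborel (\<lambda>x. f (k * x))" "(\<integral>x. f x \<partial>lborel) = k * (\<integral>x. f (k * x) \<partial>lborel)"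
    if "integrable lborel f" for f :: "real \<Rightarrow> real"
    using lborel_integrable_real_affine[OF that, of k 0] lborel_integral_real_affine[of k f 0] k
    by simp_all
  have ks: "k / sqrt (2 * pi) = sqrt c"
    by (simp add: k_def real_sqrt_mult)
  have sc: "sqrt c * y = z \<longleftrightarrow> y = z / sqrt c" for y z
    using c by (auto simp: field_simps)
  note C = std_gauss_cos_sin(1)[of t] and S = std_gauss_cos_sin(2)[of t]
  show "integrable lborel (\<lambda>x. exp (- (pi * c * x\<^sup>2)) * cos (2 * pi * u * x))"
  proof -
    have "integrable lborel (\<lambda>x. sqrt (2 * pi) * (std_normal_density (k * x) * cos (t * (k * x))))"
      by (intro integrable_mult_right aff(1)[OF C])
    then show ?thesis
      by (simp add: dens tk)
  qed
  show "integrable lborel (\<lambda>x. exp (- (pi * c * x\<^sup>2)) * sin (2 * pi * u * x))"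
  proof -
    have "integrable lborel (\<lambda>x. sqrt (2 * pi) * (std_normal_density (k * x) * sin (t * (k * x))))"
      by (intro integrable_mult_right aff(1)[OF S])
    then show ?thesis
      by (simp add: dens tk)
  qed
  have "exp (- t\<^sup>2 / 2) = k * (\<integral>x. exp (- (pi * c * x\<^sup>2)) / sqrt (2 * pi) * cos (2 * pi * u * x) \<partial>lborel)"
    using aff(2)[OF C] by (simp only: std_gauss_cos_sin dens tk)
  also have "\<dots> = k / sqrt (2 * pi) * (\<integral>x. exp (- (pi * c * x\<^sup>2)) * cos (2 * pi * u * x) \<partial>lborel)"
    by simp
  finally have "sqrt c * (\<integral>x. exp (- (pi * c * x\<^sup>2)) * cos (2 * pi * u * x) \<partial>lborel) = exp (- (t\<^sup>2 / 2))"
    by (simp only: ks) simp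
  then show "(\<integral>x. exp (- (pi * c * x\<^sup>2)) * cos (2 * pi * u * x) \<partial>lborel) = exp (- (pi * u\<^sup>2 / c)) / sqrt c"
    by (simp only: sc tt)
  have "0 = k * (\<integral>x. exp (- (pi * c * x\<^sup>2)) / sqrt (2 * pi) * sin (2 * pi * u * x) \<partial>lborel)"
    using aff(2)[OF S] by (simp only: std_gauss_cos_sin dens tk)
  then show "(\<integral>x. exp (- (pi * c * x\<^sup>2)) * sin (2 * pi * u * x) \<partial>lborel) = 0"
    using k by simp
qed

lemma gauss_integral:
  assumes c: "0 < c"
  shows "integrable lborel (\<lambda>x. exp (- (pi * c * x\<^sup>2)))"
    and "(\<integral>x. exp (- (pi * c * x\<^sup>2)) \<partial>lborel) = 1 / sqrt c"
  using gauss_cos_sin(1,3)[OF c, of 0] by simp_all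

section \<open>Plancherel's identity\<close>

lemma integrable_pair_mult:
  fixes f :: "'a :: euclidean_space \<Rightarrow> real" and g :: "'b :: euclidean_space \<Rightarrow> real"
  assumes "integrable lborel f" "integrable lborel g"
  shows "integrable (lborel \<Otimes>\<^sub>M lborel) (\<lambda>p. f (fst p) * g (snd p))"
proof (rule lborel_pair.Fubini_integrable)
  have [measurable]: "f \<in> borel_measurable lborel" "g \<in> borel_measurable lborel"
    using assms by (auto dest: borel_measurable_integrable)
  show "(\<lambda>p. f (fst p) * g (snd p)) \<in> borel_measurable (lborel \<Otimes>\<^sub>M lborel)"
    by measurable
qed (use assms in \<open>auto simp: abs_mult\<close>)

text \<open>The rotation stands to the left of \<open>h t\<close>, the side on which the
  Segal-Bargmann kernel acts; in general the two factors do not commute.\<close>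

definition quat_fourier :: "quat \<Rightarrow> (real \<Rightarrow> quat) \<Rightarrow> real \<Rightarrow> quat" where
  "quat_fourier I h \<omega> = (\<integral>t. rot I (2 * pi * \<omega> * t) * h t \<partial>lborel)"

lemma quat_fourier_measurable [measurable]:
  assumes [measurable]: "h \<in> borel_measurable borel"
  shows "quat_fourier I h \<in> borel_measurable borel"
  unfolding quat_fourier_def[abs_def] by measurable

lemma integrable_rot_mult:
  assumes "I \<in> imag_units" "integrable lborel h" and [measurable]: "g \<in> borel_measurable lborel"
  shows "integrable lborel (\<lambda>t. rot I (g t) * h t)"
proof (rule Bochner_Integration.integrable_bound[OF assms(2)])
  have [measurable]: "h \<in> borel_measurable lborel"
    using assms by auto
  show "(\<lambda>t. rot I (g t) * h t) \<in> borel_measurable lborel"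
    by measurable
qed (simp add: norm_rot_mult[OF assms(1)])

lemma norm_quat_fourier_le:
  assumes "I \<in> imag_units"
  shows "norm (quat_fourier I h \<omega>) \<le> (\<integral>t. norm (h t) \<partial>lborel)"
  unfolding quat_fourier_def
  using integral_norm_bound[of lborel "\<lambda>t. rot I (2 * pi * \<omega> * t) * h t"]
  by (simp add: norm_rot_mult[OF assms])

text \<open>The square is the inner product of the integral with itself. Moving \<open>inner\<close>
  under both integrals leaves pairs of rotations, which \<open>inner_rot\<close> reduces to the
  phase difference.\<close>

lemma norm_quat_fourier_sq:
  assumes I: "I \<in> imag_units" and h: "integrable lborel h"
  shows "(norm (quat_fourier I h \<omega>))\<^sup>2 = (\<integral>s. \<integral>t. cos (2 * pi * (s - t) * \<omega>) * inner (h s) (h t)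
    + sin (2 * pi * (s - t) * \<omega>) * inner (h s) (I * h t) \<partial>lborel \<partial>lborel)"
proof -
  define k where "k t = rot I (2 * pi * \<omega> * t) * h t" for t
  have k: "integrable lborel k"
    unfolding k_def by (rule integrable_rot_mult[OF I h]) measurable
  have "(norm (quat_fourier I h \<omega>))\<^sup>2 = (\<integral>s. inner (k s) (integral\<^sup>L lborel k) \<partial>lborel)"
    using k by (simp add: quat_fourier_def k_def[symmetric] power2_norm_eq_inner)
  also have "\<dots> = (\<integral>s. \<integral>t. inner (k s) (k t) \<partial>lborel \<partial>lborel)"
    using k by simp
  also have "(\<lambda>s t. inner (k s) (k t)) = (\<lambda>s t. cos (2 * pi * (s - t) * \<omega>) * inner (h s) (h t)
    + sin (2 * pi * (s - t) * \<omega>) * inner (h s) (I * h t))"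
    unfolding k_def inner_rot[OF I] by (simp add: algebra_simps)
  finally show ?thesis .
qed

text \<open>Expanding the square and integrating over the frequency first leaves a Gaussian kernel applied
  to the autocorrelation of \<open>h\<close>; the \<open>I\<close>-part vanishes because it is odd in the frequency.\<close>

lemma gaussian_mean_quat_fourier:
  assumes I: "I \<in> imag_units" and h: "integrable lborel h"
    and h2: "integrable lborel (\<lambda>t. (norm (h t))\<^sup>2)" and c: "0 < c"
  shows "(\<integral>\<omega>. exp (- (pi * c * \<omega>\<^sup>2)) * (norm (quat_fourier I h \<omega>))\<^sup>2 \<partial>lborel)
    = (\<integral>v. exp (- (pi * v\<^sup>2)) * (\<integral>s. inner (h s) (h (s + sqrt c * v)) \<partial>lborel) \<partial>lborel)"
proof -
  have [measurable]: "h \<in> borel_measurable borel"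
    using h by auto
  \<comment> \<open>The Fourier transform of the damping Gaussian, as computed in
    \<open>gauss_cos_sin\<close>.\<close>
  define K where "K u = exp (- (pi * u\<^sup>2 / c)) / sqrt c" for u
  have [measurable]: "K \<in> borel_measurable borel"
    unfolding K_def[abs_def] by measurable
  have K: "integrable lborel K"
    using gauss_integral(1)[of "1 / c"] c unfolding K_def by (simp add: field_simps)
  have K_nonneg: "0 \<le> K u" for u
    using c by (simp add: K_def)
  define P where "P \<omega> p = cos (2 * pi * (fst p - snd p) * \<omega>) * inner (h (fst p)) (h (snd p))
    + sin (2 * pi * (fst p - snd p) * \<omega>) * inner (h (fst p)) (I * h (snd p))" for \<omega> p
  have [measurable]: "(\<lambda>x. P (a x) (b x)) \<in> borel_measurable M"
    if [measurable]: "a \<in> borel_measurable M" "b \<in> M \<rightarrow>\<^sub>M borel \<Otimes>\<^sub>M borel" for a b and M :: "'z measure"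
    unfolding P_def by measurable
  \<comment> \<open>The bound is independent of the frequency, and it is integrable over pairs
    because \<open>h\<close> is integrable. With the Gaussian factor this justifies the first
    interchange.\<close>
  have P_le: "\<bar>P \<omega> p\<bar> \<le> 2 * (norm (h (fst p)) * norm (h (snd p)))" for \<omega> p
  proof -
    have nI: "norm (I * x) = norm x" for x
      \<comment> \<open>Rotation by the angle -pi/2 is left multiplication by
        \<open>I\<close>.\<close>
      using norm_rot_mult[OF I, of "- pi / 2" x] by (simp add: rot_mult)
    have k_le: "\<bar>k * inner x y\<bar> \<le> norm x * norm y" if "\<bar>k\<bar> \<le> 1" for k and x y :: quat
      using mult_mono[OF that Cauchy_Schwarz_ineq2[of x y]] by (simp add: abs_mult)
    have "\<bar>P \<omega> p\<bar> \<le> norm (h (fst p)) * norm (h (snd p)) + norm (h (fst p)) * norm (I * h (snd p))"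
      unfolding P_def by (intro order_trans[OF abs_triangle_ineq] add_mono k_le) simp_all
    then show ?thesis
      unfolding nI by simp
  qed
  have hh: "integrable (lborel \<Otimes>\<^sub>M lborel) (\<lambda>p. 2 * (norm (h (fst p)) * norm (h (snd p))))"
    by (intro integrable_mult_right integrable_pair_mult integrable_norm h)
  have Pint: "integrable (lborel \<Otimes>\<^sub>M lborel) (P \<omega>)" for \<omega>
    by (rule Bochner_Integration.integrable_bound[OF hh]) (use P_le in auto)
  have gP: "integrable (lborel \<Otimes>\<^sub>M (lborel \<Otimes>\<^sub>M lborel))
      (\<lambda>(\<omega>, p). exp (- (pi * c * \<omega>\<^sup>2)) * P \<omega> p)"
  proof (rule Bochner_Integration.integrable_bound)
    show "integrable (lborel \<Otimes>\<^sub>M (lborel \<Otimes>\<^sub>M lborel))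
      (\<lambda>z. exp (- (pi * c * (fst z)\<^sup>2)) * (2 * (norm (h (fst (snd z))) * norm (h (snd (snd z))))))"
      using integrable_pair_mult[OF gauss_integral(1)[OF c] hh[unfolded lborel_prod[where 'a = real and 'b = real]]]
      by (simp add: lborel_prod)
  qed (use P_le in \<open>auto simp: abs_mult intro!: mult_left_mono\<close>)
  have Pgauss: "(\<integral>\<omega>. exp (- (pi * c * \<omega>\<^sup>2)) * P \<omega> p \<partial>lborel)
      = K (snd p - fst p) * inner (h (fst p)) (h (snd p))" for p
    using gauss_cos_sin[OF c, of "fst p - snd p"]
    by (simp add: P_def distrib_left mult.assoc[symmetric] K_def power2_commute)
  have qP: "(norm (quat_fourier I h \<omega>))\<^sup>2 = (\<integral>p. P \<omega> p \<partial>(lborel \<Otimes>\<^sub>M lborel))" for \<omega>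
    unfolding lborel_pair.integral_fst'[OF Pint, symmetric]
    by (simp add: norm_quat_fourier_sq[OF I h] P_def)
  have "(\<integral>\<omega>. exp (- (pi * c * \<omega>\<^sup>2)) * (norm (quat_fourier I h \<omega>))\<^sup>2 \<partial>lborel)
      = (\<integral>\<omega>. exp (- (pi * c * \<omega>\<^sup>2)) * (\<integral>p. P \<omega> p \<partial>(lborel \<Otimes>\<^sub>M lborel)) \<partial>lborel)"
    by (simp only: qP)
  also have "\<dots> = (\<integral>\<omega>. \<integral>p. exp (- (pi * c * \<omega>\<^sup>2)) * P \<omega> p \<partial>(lborel \<Otimes>\<^sub>M lborel) \<partial>lborel)"
    by simp
  also have "\<dots> = (\<integral>p. \<integral>\<omega>. exp (- (pi * c * \<omega>\<^sup>2)) * P \<omega> p \<partial>lborel \<partial>(lborel \<Otimes>\<^sub>M lborel))"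
    using lborel_pair.Fubini_integral[OF gP[unfolded lborel_prod[where 'a = real and 'b = real]]]
    by (simp add: lborel_prod)
  also have "\<dots> = (\<integral>p. K (snd p - fst p) * inner (h (fst p)) (h (snd p)) \<partial>(lborel \<Otimes>\<^sub>M lborel))"
    by (simp only: Pgauss)
  also have "\<dots> = (\<integral>s. \<integral>t. K (t - s) * inner (h s) (h t) \<partial>lborel \<partial>lborel)"
  proof -
    have "integrable (lborel \<Otimes>\<^sub>M lborel) (\<lambda>p. K (snd p - fst p) * inner (h (fst p)) (h (snd p)))"
    proof (rule Bochner_Integration.integrable_bound)
      show "integrable (lborel \<Otimes>\<^sub>M lborel) (\<lambda>p. 1 / sqrt c * (norm (h (fst p)) * norm (h (snd p))))"
        by (intro integrable_mult_right integrable_pair_mult integrable_norm h)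
      have "\<bar>K u\<bar> \<le> 1 / sqrt c" for u
        using c by (auto simp: K_def intro!: divide_right_mono)
      then have "\<bar>K u * inner x y\<bar> \<le> 1 / sqrt c * (norm x * norm y)" for u and x y :: quat
        unfolding abs_mult using c by (intro mult_mono Cauchy_Schwarz_ineq2) auto
      then show "AE p in lborel \<Otimes>\<^sub>M lborel. norm (K (snd p - fst p) * inner (h (fst p)) (h (snd p)))
          \<le> norm (1 / sqrt c * (norm (h (fst p)) * norm (h (snd p))))"
        using c by (intro AE_I2) (simp add: abs_mult)
    qed measurable
    from lborel_pair.integral_fst'[OF this] show ?thesis
      by simp
  qed
  also have "\<dots> = (\<integral>s. \<integral>u. K u * inner (h s) (h (s + u)) \<partial>lborel \<partial>lborel)"
  proof (rule Bochner_Integration.integral_cong[OF refl])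
    fix s
    show "(\<integral>t. K (t - s) * inner (h s) (h t) \<partial>lborel) = (\<integral>u. K u * inner (h s) (h (s + u)) \<partial>lborel)"
      using integral_translate[of "\<lambda>t. K (t - s) * inner (h s) (h t)" s] by (simp add: add.commute)
  qed
  \<comment> \<open>The second interchange rests on square integrability: for each shift the inner
    integral of absolute values is at most twice the square norm of \<open>h\<close>, and
    \<open>K\<close> is integrable.\<close>
  also have "\<dots> = (\<integral>u. \<integral>s. K u * inner (h s) (h (s + u)) \<partial>lborel \<partial>lborel)"
  proof (rule lborel_pair.Fubini_integral)
    have h2': "integrable lborel (\<lambda>s. (norm (h (s + u)))\<^sup>2)" for u
      using integrable_translate[OF h2] by simp
    have ih: "integrable lborel (\<lambda>s. inner (h s) (h (s + u)))" for u
      by (intro integrable_inner_of_sq h2 h2') auto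
    show "integrable (lborel \<Otimes>\<^sub>M lborel) (\<lambda>(u, s). K u * inner (h s) (h (s + u)))"
    proof (rule lborel_pair.Fubini_integrable)
      have "(\<integral>s. \<bar>inner (h s) (h (s + u))\<bar> \<partial>lborel) \<le> 2 * (\<integral>s. (norm (h s))\<^sup>2 \<partial>lborel)" for u
      proof -
        have "(\<integral>s. \<bar>inner (h s) (h (s + u))\<bar> \<partial>lborel)
            \<le> (\<integral>s. (norm (h s))\<^sup>2 + (norm (h (s + u)))\<^sup>2 \<partial>lborel)"
          using ih h2 h2' abs_inner_le_sq by (intro integral_mono) auto
        also have "\<dots> = 2 * (\<integral>s. (norm (h s))\<^sup>2 \<partial>lborel)"
          using h2 h2' integral_translate[of "\<lambda>s. (norm (h s))\<^sup>2" u] by simp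
        finally show ?thesis .
      qed
      then have le: "\<bar>K u * (\<integral>s. \<bar>inner (h s) (h (s + u))\<bar> \<partial>lborel)\<bar>
          \<le> K u * (2 * (\<integral>s. (norm (h s))\<^sup>2 \<partial>lborel))" for u
        using K_nonneg by (simp add: abs_mult mult_left_mono integral_nonneg_AE)
      show "integrable lborel (\<lambda>u. \<integral>s. norm (case (u, s) of (u, s) \<Rightarrow> K u * inner (h s) (h (s + u))) \<partial>lborel)"
      proof (rule Bochner_Integration.integrable_bound)
        show "integrable lborel (\<lambda>u. K u * (2 * (\<integral>s. (norm (h s))\<^sup>2 \<partial>lborel)))"
          using K by simp
        show "AE u in lborel. norm (\<integral>s. norm (case (u, s) of (u, s) \<Rightarrow> K u * inner (h s) (h (s + u))) \<partial>lborel)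
            \<le> norm (K u * (2 * (\<integral>s. (norm (h s))\<^sup>2 \<partial>lborel)))"
        proof (rule AE_I2)
          fix u
          have "(\<integral>s. norm (case (u, s) of (u, s) \<Rightarrow> K u * inner (h s) (h (s + u))) \<partial>lborel)
              = K u * (\<integral>s. \<bar>inner (h s) (h (s + u))\<bar> \<partial>lborel)"
            using K_nonneg[of u] by (simp add: abs_mult)
          with le[of u] K_nonneg[of u] show "norm (\<integral>s. norm (case (u, s) of (u, s) \<Rightarrow> K u * inner (h s) (h (s + u))) \<partial>lborel)
              \<le> norm (K u * (2 * (\<integral>s. (norm (h s))\<^sup>2 \<partial>lborel)))"
            by (simp only: real_norm_def)
        qed
      qed measurable
      show "AE u in lborel. integrable lborel (\<lambda>s. case (u, s) of (u, s) \<Rightarrow> K u * inner (h s) (h (s + u)))"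
        using ih by simp
    qed measurable
  qed
  also have "\<dots> = (\<integral>u. K u * (\<integral>s. inner (h s) (h (s + u)) \<partial>lborel) \<partial>lborel)"
    by simp
  \<comment> \<open>The scaling u = sqrt c v makes the weight independent of \<open>c\<close>, which
    then enters only through the shift.\<close>
  also have "\<dots> = sqrt c * (\<integral>v. K (sqrt c * v) * (\<integral>s. inner (h s) (h (s + sqrt c * v)) \<partial>lborel) \<partial>lborel)"
    using lborel_integral_real_affine[of "sqrt c" "\<lambda>u. K u * (\<integral>s. inner (h s) (h (s + u)) \<partial>lborel)" 0] c
    by simp
  also have "\<dots> = (\<integral>v. sqrt c * (K (sqrt c * v) * (\<integral>s. inner (h s) (h (s + sqrt c * v)) \<partial>lborel)) \<partial>lborel)"
    by simp
  also have "\<dots> = (\<integral>v. exp (- (pi * v\<^sup>2)) * (\<integral>s. inner (h s) (h (s + sqrt c * v)) \<partial>lborel) \<partial>lborel)"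
    using c by (simp add: K_def power_mult_distrib)
  finally show ?thesis .
qed

text \<open>The damped identity passes to the limit by two different theorems: monotone convergence
  on the frequency side, where integrability of the square is still unknown, and dominated
  convergence on the autocorrelation side.\<close>

lemma quat_plancherel:
  assumes I: "I \<in> imag_units" and h: "integrable lborel h"
    and h2: "integrable lborel (\<lambda>t. (norm (h t))\<^sup>2)"
  shows "(\<integral>\<^sup>+\<omega>. ennreal ((norm (quat_fourier I h \<omega>))\<^sup>2) \<partial>lborel) = (\<integral>\<^sup>+t. ennreal ((norm (h t))\<^sup>2) \<partial>lborel)"
proof -
  have hm [measurable]: "h \<in> borel_measurable borel"
    using h by auto
  define d where "d n = 1 / real (Suc n)" for n
  have d: "0 < d n" "d \<longlonglongrightarrow> 0" "decseq d" for n
    unfolding d_def using LIMSEQ_inverse_real_of_nat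
    by (simp_all add: inverse_eq_divide decseq_def frac_le)
  \<comment> \<open>Damping by the square of \<open>d n\<close> makes the shift exactly
    \<open>d n * v\<close>; since \<open>d\<close> decreases, the damped integrands
    increase.\<close>
  define G where "G n = (\<integral>\<omega>. exp (- (pi * (d n)\<^sup>2 * \<omega>\<^sup>2)) * (norm (quat_fourier I h \<omega>))\<^sup>2 \<partial>lborel)" for n
  define A where "A u = (\<integral>s. inner (h s) (h (s + u)) \<partial>lborel)" for u
  define H where "H = (\<integral>t. (norm (h t))\<^sup>2 \<partial>lborel)"
  have [measurable]: "A \<in> borel_measurable borel"
    unfolding A_def[abs_def] by measurable
  have G_eq: "G n = (\<integral>v. exp (- (pi * v\<^sup>2)) * A (d n * v) \<partial>lborel)" for n
    using gaussian_mean_quat_fourier[OF I h h2, of "(d n)\<^sup>2"] d(1)[of n] by (simp add: G_def A_def)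
  have "G \<longlonglongrightarrow> (\<integral>v. exp (- (pi * v\<^sup>2)) * H \<partial>lborel)"
    unfolding G_eq
  proof (rule integral_dominated_convergence[where w = "\<lambda>v. exp (- (pi * v\<^sup>2)) * H"])
    show "integrable lborel (\<lambda>v. exp (- (pi * v\<^sup>2)) * H)"
      using gauss_integral(1)[of 1] by simp
    show "AE v in lborel. (\<lambda>n. exp (- (pi * v\<^sup>2)) * A (d n * v)) \<longlonglongrightarrow> exp (- (pi * v\<^sup>2)) * H"
    proof (rule AE_I2)
      fix v
      have "(\<lambda>n. d n * v) \<longlonglongrightarrow> 0"
        using tendsto_mult[OF d(2) tendsto_const, of v] by simp
      then show "(\<lambda>n. exp (- (pi * v\<^sup>2)) * A (d n * v)) \<longlonglongrightarrow> exp (- (pi * v\<^sup>2)) * H"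
        unfolding A_def H_def by (intro tendsto_mult tendsto_const autocorrelation_tendsto hm h2)
    qed
    show "AE v in lborel. norm (exp (- (pi * v\<^sup>2)) * A (d n * v)) \<le> exp (- (pi * v\<^sup>2)) * H" for n
      using autocorrelation_abs_le[OF hm h2] by (simp add: abs_mult A_def H_def)
  qed measurable
  then have "G \<longlonglongrightarrow> H"
    using gauss_integral(2)[of 1] by simp
  then have lim1: "(\<lambda>n. ennreal (G n)) \<longlonglongrightarrow> ennreal H"
    by (rule tendsto_ennrealI)
  have nn: "(\<integral>\<^sup>+\<omega>. ennreal (exp (- (pi * (d n)\<^sup>2 * \<omega>\<^sup>2)) * (norm (quat_fourier I h \<omega>))\<^sup>2) \<partial>lborel) = ennreal (G n)" for n
    unfolding G_def
  proof (rule nn_integral_eq_integral)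
    \<comment> \<open>The integral of the norm of \<open>h\<close> bounds the transform uniformly,
      so the Gaussian makes each damped square integrable.\<close>
    define B where "B = (\<integral>t. norm (h t) \<partial>lborel)"
    have B: "(norm (quat_fourier I h \<omega>))\<^sup>2 \<le> B\<^sup>2" for \<omega>
      unfolding B_def by (intro power_mono norm_quat_fourier_le[OF I]) simp
    have int: "integrable lborel (\<lambda>\<omega>. exp (- (pi * (d n)\<^sup>2 * \<omega>\<^sup>2)) * B\<^sup>2)"
      using d(1)[of n] by (intro integrable_mult_left gauss_integral(1)) simp
    show "integrable lborel (\<lambda>\<omega>. exp (- (pi * (d n)\<^sup>2 * \<omega>\<^sup>2)) * (norm (quat_fourier I h \<omega>))\<^sup>2)"
      by (rule Bochner_Integration.integrable_bound[OF int]) (simp_all add: abs_mult B)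
  qed simp
  have "(\<lambda>n. \<integral>\<^sup>+\<omega>. ennreal (exp (- (pi * (d n)\<^sup>2 * \<omega>\<^sup>2)) * (norm (quat_fourier I h \<omega>))\<^sup>2) \<partial>lborel)
      \<longlonglongrightarrow> (\<integral>\<^sup>+\<omega>. ennreal ((norm (quat_fourier I h \<omega>))\<^sup>2) \<partial>lborel)"
  proof (rule nn_integral_LIMSEQ)
    have "(d n)\<^sup>2 \<le> (d m)\<^sup>2" if "m \<le> n" for m n
      using d(3) that d(1)[of n] by (intro power_mono) (auto simp: decseq_def less_imp_le)
    then have "exp (- (pi * (d m)\<^sup>2 * \<omega>\<^sup>2)) \<le> exp (- (pi * (d n)\<^sup>2 * \<omega>\<^sup>2))" if "m \<le> n" for m n \<omega>
      using that by (simp add: mult_right_mono)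
    then show "incseq (\<lambda>n \<omega>. ennreal (exp (- (pi * (d n)\<^sup>2 * \<omega>\<^sup>2)) * (norm (quat_fourier I h \<omega>))\<^sup>2))"
      unfolding incseq_def le_fun_def by (intro allI impI ennreal_leI mult_right_mono) auto
    fix \<omega>
    have "(\<lambda>n. ennreal (exp (- (pi * (d n)\<^sup>2 * \<omega>\<^sup>2)) * (norm (quat_fourier I h \<omega>))\<^sup>2))
        \<longlonglongrightarrow> ennreal (exp (- (pi * 0\<^sup>2 * \<omega>\<^sup>2)) * (norm (quat_fourier I h \<omega>))\<^sup>2)"
      by (intro tendsto_ennrealI tendsto_mult tendsto_exp tendsto_minus tendsto_power tendsto_const d)
    then show "(\<lambda>n. ennreal (exp (- (pi * (d n)\<^sup>2 * \<omega>\<^sup>2)) * (norm (quat_fourier I h \<omega>))\<^sup>2))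
        \<longlonglongrightarrow> ennreal ((norm (quat_fourier I h \<omega>))\<^sup>2)"
      by simp
  qed measurable
  then have "(\<integral>\<^sup>+\<omega>. ennreal ((norm (quat_fourier I h \<omega>))\<^sup>2) \<partial>lborel) = ennreal H"
    unfolding nn by (rule LIMSEQ_unique[OF _ lim1])
  also have "\<dots> = (\<integral>\<^sup>+t. ennreal ((norm (h t))\<^sup>2) \<partial>lborel)"
    unfolding H_def by (rule nn_integral_eq_integral[symmetric]) (use h2 in auto)
  finally show ?thesis .
qed

section \<open>The short-time Fourier transform with Gaussian window\<close>

text \<open>Each real coordinate agrees almost everywhere with a Borel function, and finitely many
  null sets unite to a null set. A Borel representative gives the joint measurability that Tonelli
  requires.\<close>

lemma lebesgue_ex_borel:
  fixes f :: "'a :: euclidean_space \<Rightarrow> 'b :: euclidean_space"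
  assumes f: "f \<in> borel_measurable lebesgue"
  obtains g where "g \<in> borel_measurable borel" "AE x in lborel. f x = g x"
proof -
  have "\<exists>g\<in>borel_measurable lborel. AE x in lborel. inner (f x) b = g x" for b
    by (rule completion_ex_borel_measurable_real) (use f in measurable)
  then obtain g where g: "\<And>b. g b \<in> borel_measurable lborel" "\<And>b. AE x in lborel. inner (f x) b = g b x"
    by metis
  have "AE x in lborel. \<forall>b\<in>Basis. inner (f x) b = g b x"
    by (rule AE_finite_allI) (use g in auto)
  then have "AE x in lborel. f x = (\<Sum>b\<in>Basis. g b x *\<^sub>R b)"
  proof eventually_elim
    case (elim x)
    have "f x = (\<Sum>b\<in>Basis. inner (f x) b *\<^sub>R b)"
      by (rule euclidean_representation[symmetric])
    with elim show ?case
      by simp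
  qed
  moreover have "(\<lambda>x. \<Sum>b\<in>Basis. g b x *\<^sub>R b) \<in> borel_measurable borel"
    using g(1) by simp
  ultimately show thesis
    using that by blast
qed

text \<open>The quaternionic product of \<open>F\<close> with itself is a real multiple of 1, and
  the nonnegative integral is unchanged by completion. This moves the norm to \<open>lborel\<close>,
  where iterated integration is carried out.\<close>

lemma L2_norm_eq:
  assumes "F \<in> L2"
  shows "L2_norm F = sqrt (enn2real (\<integral>\<^sup>+x. ennreal ((norm (F x))\<^sup>2) \<partial>lborel))"
proof -
  have F: "integrable lebesgue (\<lambda>x. (norm (F x))\<^sup>2)"
    using assms by (simp add: L2_def)
  have "L2_inner F F = (LINT x|lebesgue. (norm (F x))\<^sup>2 *\<^sub>R 1)"
    by (simp add: L2_inner_def quat_cnj_mult_self of_real_def)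
  also have "\<dots> = (LINT x|lebesgue. (norm (F x))\<^sup>2) *\<^sub>R 1"
    using F by (intro integral_scaleR_left) simp
  finally have "L2_norm F = sqrt (LINT x|lebesgue. (norm (F x))\<^sup>2)"
    by (simp add: L2_norm_def)
  also have "(LINT x|lebesgue. (norm (F x))\<^sup>2) = enn2real (\<integral>\<^sup>+x. ennreal ((norm (F x))\<^sup>2) \<partial>lebesgue)"
    using F by (intro integral_eq_nn_integral) auto
  finally show ?thesis
    by (simp add: nn_integral_completion)
qed

lemma L2I:
  assumes "F \<in> borel_measurable borel" "(\<integral>\<^sup>+x. ennreal ((norm (F x))\<^sup>2) \<partial>lborel) < \<infinity>"
  shows "F \<in> L2"
proof -
  have "F \<in> borel_measurable lebesgue"
    using assms(1) by (simp add: measurable_completion)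
  with assms(2) show ?thesis
    by (simp add: L2_def integrable_iff_bounded nn_integral_completion)
qed

section \<open>The Gaussian window and the windowed functions\<close>

lemma nn_integral_gaussian_translate:
  "(\<integral>\<^sup>+x. ennreal (exp (- (pi * 2 * (x - t)\<^sup>2))) \<partial>lborel) = ennreal (1 / sqrt 2)"
proof -
  have "integrable lborel (\<lambda>x. exp (- (pi * 2 * (x - t)\<^sup>2)))"
    using integrable_translate[OF gauss_integral(1)[of 2], of "- t"] by simp
  then have "(\<integral>\<^sup>+x. ennreal (exp (- (pi * 2 * (x - t)\<^sup>2))) \<partial>lborel)
      = ennreal (\<integral>x. exp (- (pi * 2 * (x - t)\<^sup>2)) \<partial>lborel)"
    by (rule nn_integral_eq_integral) simp
  then show ?thesis
    using integral_translate[of "\<lambda>x. exp (- (pi * 2 * x\<^sup>2))" "- t"] gauss_integral(2)[of 2] by simp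
qed

text \<open>Supplies the hypotheses of Plancherel for every \<open>x\<close>, without exceptional
  points. A product is at most the sum of the squares of its factors, which gives integrability; the
  window is at most 1, which gives square integrability.\<close>

lemma windowed_integrable:
  fixes g :: "real \<Rightarrow> quat"
  assumes [measurable]: "g \<in> borel_measurable borel" and g2: "integrable lborel (\<lambda>t. (norm (g t))\<^sup>2)"
  shows "integrable lborel (\<lambda>t. exp (- (pi * (x - t)\<^sup>2)) *\<^sub>R g t)"
    and "integrable lborel (\<lambda>t. (norm (exp (- (pi * (x - t)\<^sup>2)) *\<^sub>R g t))\<^sup>2)"
proof -
  have gauss2: "integrable lborel (\<lambda>t. exp (- (pi * 2 * (x - t)\<^sup>2)))"
    using integrable_translate[OF gauss_integral(1)[of 2], of "- x"] by (simp add: power2_commute)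
  have sq: "(exp (- (pi * (x - t)\<^sup>2)))\<^sup>2 = exp (- (pi * 2 * (x - t)\<^sup>2))" for t
    by (simp add: exp_double[symmetric] mult.assoc)
  show "integrable lborel (\<lambda>t. exp (- (pi * (x - t)\<^sup>2)) *\<^sub>R g t)"
  proof (rule Bochner_Integration.integrable_bound)
    show "integrable lborel (\<lambda>t. exp (- (pi * 2 * (x - t)\<^sup>2)) + (norm (g t))\<^sup>2)"
      using gauss2 g2 by simp
    show "AE t in lborel. norm (exp (- (pi * (x - t)\<^sup>2)) *\<^sub>R g t)
        \<le> norm (exp (- (pi * 2 * (x - t)\<^sup>2)) + (norm (g t))\<^sup>2)"
      using abs_inner_le_sq[of "exp (- (pi * (x - t)\<^sup>2))" "norm (g t)" for t]
      by (intro AE_I2) (simp add: sq abs_mult)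
  qed measurable
  show "integrable lborel (\<lambda>t. (norm (exp (- (pi * (x - t)\<^sup>2)) *\<^sub>R g t))\<^sup>2)"
    by (rule Bochner_Integration.integrable_bound[OF g2])
      (auto simp: power_mult_distrib sq intro!: AE_I2 mult_left_le_one_le)
qed

text \<open>Completing the square splits the real exponent into pi (x^2 + omega^2) / 2 and the
  window. The first part cancels against the final Gaussian factor because |q|^2 = x^2 + omega^2,
  and the prefactor removes the phase pi x omega. The identity holds at every point although
  \<open>f\<close> and \<open>g\<close> agree only almost everywhere, since \<open>f\<close> enters
  only through an integral.\<close>

lemma qstft_gauss_eq:
  assumes I: "I \<in> imag_units" and f [measurable]: "f \<in> borel_measurable lebesgue"
    and g [measurable]: "g \<in> borel_measurable borel" and fg: "AE t in lborel. f t = g t"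
    and g2: "integrable lborel (\<lambda>t. (norm (g t))\<^sup>2)"
  shows "qstft_gauss I f (x, \<omega>)
    = 2 powr (3/4) *\<^sub>R quat_fourier I (\<lambda>t. exp (- (pi * (x - t)\<^sup>2)) *\<^sub>R g t) \<omega>"
proof -
  note I' = imag_unitsD[OF I]
  define h where "h t = exp (- (pi * (x - t)\<^sup>2)) *\<^sub>R g t" for t
  have h: "integrable lborel h"
    unfolding h_def by (rule windowed_integrable[OF g g2])
  define C where "C = 2 powr (3/4) * exp (pi * (x\<^sup>2 + \<omega>\<^sup>2) / 2)"
  define k where "k t = rot I (2 * pi * \<omega> * t - pi * x * \<omega>) * h t" for t
  have k: "integrable lborel k"
    unfolding k_def by (rule integrable_rot_mult[OF I h]) measurable
  define q where "q = of_real x + I * of_real \<omega>"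
  have exponent: "- (pi * ((x\<^sup>2 - \<omega>\<^sup>2) / 2 + t\<^sup>2)) + 2 * pi * x * t
      = pi * (x\<^sup>2 + \<omega>\<^sup>2) / 2 + - (pi * (x - t)\<^sup>2)" for t
    by (simp add: power2_eq_square algebra_simps add_divide_distrib diff_divide_distrib)
  have kernel: "of_real (2 powr (3/4))
        * exp (- (of_real pi * ((quat_cnj q /\<^sub>R sqrt 2)\<^sup>2 + of_real (t\<^sup>2)))
            + of_real (2 * pi * sqrt 2) * (quat_cnj q /\<^sub>R sqrt 2) * of_real t)
      = C *\<^sub>R exp (- (pi * (x - t)\<^sup>2)) *\<^sub>R rot I (2 * pi * \<omega> * t - pi * x * \<omega>)" for t
    unfolding q_def segal_bargmann_kernel[OF I] exponent exp_add C_def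
    by (simp only: scaleR_conv_of_real of_real_mult mult.assoc)
  have kernel': "C *\<^sub>R exp (- (pi * (x - t)\<^sup>2)) *\<^sub>R rot I (2 * pi * \<omega> * t - pi * x * \<omega>) * g t
      = C *\<^sub>R k t" for t
    by (simp add: k_def h_def)
  have "segal_bargmann f (quat_cnj q /\<^sub>R sqrt 2) = (LINT t|lebesgue.
      C *\<^sub>R exp (- (pi * (x - t)\<^sup>2)) *\<^sub>R rot I (2 * pi * \<omega> * t - pi * x * \<omega>) * f t)"
    by (simp only: segal_bargmann_def kernel)
  also have "\<dots> = (LINT t|lebesgue. C *\<^sub>R k t)"
  proof (rule integral_cong_AE)
    have [measurable]: "(\<lambda>t. t) \<in> borel_measurable lebesgue" "g \<in> borel_measurable lebesgue"
      by (auto intro: measurable_completion)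
    show "(\<lambda>t. C *\<^sub>R exp (- (pi * (x - t)\<^sup>2)) *\<^sub>R rot I (2 * pi * \<omega> * t - pi * x * \<omega>) * f t)
        \<in> borel_measurable lebesgue"
      by measurable
    show "(\<lambda>t. C *\<^sub>R k t) \<in> borel_measurable lebesgue"
      unfolding kernel'[symmetric] by measurable
    show "AE t in lebesgue. C *\<^sub>R exp (- (pi * (x - t)\<^sup>2)) *\<^sub>R rot I (2 * pi * \<omega> * t - pi * x * \<omega>) * f t
        = C *\<^sub>R k t"
      using AE_completion[OF fg] by eventually_elim (simp only: kernel')
  qed
  also have "\<dots> = (\<integral>t. C *\<^sub>R k t \<partial>lborel)"
    using k by (intro integral_completion) auto
  also have "\<dots> = C *\<^sub>R integral\<^sup>L lborel k"
    by simp
  finally have sb: "segal_bargmann f (quat_cnj q /\<^sub>R sqrt 2) = C *\<^sub>R integral\<^sup>L lborel k" .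
  have "rot I (pi * x * \<omega>) * k t = rot I (2 * pi * \<omega> * t) * h t" for t
    unfolding k_def mult.assoc[symmetric] rot_add[OF I'(2)] by simp
  then have "quat_fourier I h \<omega> = (\<integral>t. rot I (pi * x * \<omega>) * k t \<partial>lborel)"
    by (simp only: quat_fourier_def)
  also have "\<dots> = rot I (pi * x * \<omega>) * integral\<^sup>L lborel k"
    by (rule Bochner_Integration.integral_mult_right) (rule k)
  finally have rk: "rot I (pi * x * \<omega>) * integral\<^sup>L lborel k = quat_fourier I h \<omega>" ..
  have "(quat.Im1 I)\<^sup>2 + (quat.Im2 I)\<^sup>2 + (quat.Im3 I)\<^sup>2 = (norm I)\<^sup>2"
    unfolding power2_norm_eq_inner by (simp add: inner_quat_def I'(1) power2_eq_square)
  then have n: "(quat.Im1 I)\<^sup>2 + (quat.Im2 I)\<^sup>2 + (quat.Im3 I)\<^sup>2 = 1"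
    by (simp add: I'(3))
  have "(norm q)\<^sup>2 = x\<^sup>2 + ((quat.Im1 I)\<^sup>2 + (quat.Im2 I)\<^sup>2 + (quat.Im3 I)\<^sup>2) * \<omega>\<^sup>2"
    unfolding power2_norm_eq_inner q_def
    by (simp add: inner_quat_def I'(1) power2_eq_square algebra_simps)
  then have nq: "(norm q)\<^sup>2 = x\<^sup>2 + \<omega>\<^sup>2"
    by (simp add: n)
  have "qstft_gauss I f (x, \<omega>) = rot I (pi * x * \<omega>) * (C *\<^sub>R integral\<^sup>L lborel k)
      * of_real (exp (- (pi * (x\<^sup>2 + \<omega>\<^sup>2) / 2)))"
    by (simp only: qstft_gauss_def prod.case Let_def q_def[symmetric] sb nq exp_eq_rot[OF I'(2)])
  also have "\<dots> = (C * exp (- (pi * (x\<^sup>2 + \<omega>\<^sup>2) / 2))) *\<^sub>R quat_fourier I h \<omega>"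
    by (simp add: rk of_real_def)
  also have "C * exp (- (pi * (x\<^sup>2 + \<omega>\<^sup>2) / 2)) = 2 powr (3/4)"
    by (simp add: C_def mult.assoc flip: exp_add)
  finally show ?thesis
    by (simp add: h_def[abs_def])
qed

text \<open>Membership in \<open>L2\<close> is part of the conclusion so that the norm of the
  transform is a genuine integral and not the default value 0 of a nonintegrable function.\<close>

theorem proposition5p4:
  fixes I :: quat and f :: "real \<Rightarrow> quat"
  assumes "I \<in> imag_units"
    and "f \<in> L2"
  shows "qstft_gauss I f \<in> L2 \<and> L2_norm (qstft_gauss I f) = sqrt 2 * L2_norm f"
proof -
  note I = assms(1)
  have f: "f \<in> borel_measurable lebesgue" and f2: "integrable lebesgue (\<lambda>t. (norm (f t))\<^sup>2)"
    using assms(2) by (auto simp: L2_def)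
  obtain g where g [measurable]: "g \<in> borel_measurable borel" and fg: "AE t in lborel. f t = g t"
    using lebesgue_ex_borel[OF f] .
  define N where "N = (\<integral>\<^sup>+t. ennreal ((norm (g t))\<^sup>2) \<partial>lborel)"
  have N_f: "(\<integral>\<^sup>+t. ennreal ((norm (f t))\<^sup>2) \<partial>lborel) = N"
    unfolding N_def using fg by (intro nn_integral_cong_AE) (auto elim!: eventually_mono)
  have "N < \<infinity>"
    using f2 by (simp add: integrable_iff_bounded nn_integral_completion flip: N_f)
  then have g2: "integrable lborel (\<lambda>t. (norm (g t))\<^sup>2)"
    by (simp add: integrable_iff_bounded N_def)
  define h where "h x t = exp (- (pi * (x - t)\<^sup>2)) *\<^sub>R g t" for x t
  have V: "qstft_gauss I f z = 2 powr (3/4) *\<^sub>R quat_fourier I (h (fst z)) (snd z)" for z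
    using qstft_gauss_eq[OF I f g fg g2, of "fst z" "snd z"] by (simp add: h_def[abs_def])
  \<comment> \<open>The formula through the Borel representative makes the transform a parameter
    integral of a jointly Borel integrand.\<close>
  have V_meas [measurable]: "qstft_gauss I f \<in> borel_measurable (borel \<Otimes>\<^sub>M borel)"
  proof -
    have "(\<lambda>z. 2 powr (3/4) *\<^sub>R quat_fourier I (h (fst z)) (snd z)) \<in> borel_measurable (borel \<Otimes>\<^sub>M borel)"
      unfolding quat_fourier_def h_def by measurable
    then show ?thesis
      by (simp only: V[abs_def])
  qed
  have sq: "(2 powr (3/4))\<^sup>2 = 2 * sqrt (2::real)"
  proof -
    have "(2 powr (3/4))\<^sup>2 = 2 powr (1 + 1 / 2 :: real)"
      by (simp add: powr_power)
    also have "\<dots> = 2 * sqrt 2"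
      unfolding powr_add by (simp add: powr_half_sqrt)
    finally show ?thesis .
  qed
  have "(\<integral>\<^sup>+z. ennreal ((norm (qstft_gauss I f z))\<^sup>2) \<partial>lborel)
      = (\<integral>\<^sup>+x. \<integral>\<^sup>+\<omega>. ennreal ((norm (qstft_gauss I f (x, \<omega>)))\<^sup>2) \<partial>lborel \<partial>lborel)"
    unfolding lborel_prod[symmetric] by (rule lborel.nn_integral_fst[symmetric]) measurable
  also have "\<dots> = (\<integral>\<^sup>+x. \<integral>\<^sup>+\<omega>. ennreal (2 * sqrt 2) * ennreal ((norm (quat_fourier I (h x) \<omega>))\<^sup>2) \<partial>lborel \<partial>lborel)"
    by (simp add: V power_mult_distrib sq ennreal_mult)
  also have "\<dots> = (\<integral>\<^sup>+x. ennreal (2 * sqrt 2) * (\<integral>\<^sup>+\<omega>. ennreal ((norm (quat_fourier I (h x) \<omega>))\<^sup>2) \<partial>lborel) \<partial>lborel)"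
    unfolding quat_fourier_def h_def by (intro nn_integral_cong nn_integral_cmult) measurable
  also have "\<dots> = (\<integral>\<^sup>+x. ennreal (2 * sqrt 2) * (\<integral>\<^sup>+t. ennreal ((norm (h x t))\<^sup>2) \<partial>lborel) \<partial>lborel)"
    unfolding h_def by (simp only: quat_plancherel[OF I windowed_integrable[OF g g2]])
  also have "\<dots> = ennreal (2 * sqrt 2) * (\<integral>\<^sup>+x. \<integral>\<^sup>+t. ennreal ((norm (h x t))\<^sup>2) \<partial>lborel \<partial>lborel)"
    unfolding h_def by (intro nn_integral_cmult) measurable
  also have "(\<integral>\<^sup>+x. \<integral>\<^sup>+t. ennreal ((norm (h x t))\<^sup>2) \<partial>lborel \<partial>lborel)
      = (\<integral>\<^sup>+t. \<integral>\<^sup>+x. ennreal ((norm (h x t))\<^sup>2) \<partial>lborel \<partial>lborel)"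
    unfolding h_def by (rule lborel_pair.Fubini'[symmetric]) measurable
  also have "\<dots> = (\<integral>\<^sup>+t. \<integral>\<^sup>+x. ennreal ((norm (g t))\<^sup>2) * ennreal (exp (- (pi * 2 * (x - t)\<^sup>2))) \<partial>lborel \<partial>lborel)"
  proof -
    have "(norm (h x t))\<^sup>2 = (norm (g t))\<^sup>2 * exp (- (pi * 2 * (x - t)\<^sup>2))" for x t
      by (simp add: h_def power_mult_distrib exp_double[symmetric] mult.assoc)
    then show ?thesis
      by (simp only: ennreal_mult zero_le_power2 exp_ge_zero)
  qed
  also have "\<dots> = (\<integral>\<^sup>+t. ennreal ((norm (g t))\<^sup>2) * ennreal (1 / sqrt 2) \<partial>lborel)"
    by (simp add: nn_integral_cmult nn_integral_gaussian_translate)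
  also have "\<dots> = N * ennreal (1 / sqrt 2)"
    unfolding N_def by (rule nn_integral_multc) measurable
  also have "ennreal (2 * sqrt 2) * (N * ennreal (1 / sqrt 2)) = (ennreal (2 * sqrt 2) * ennreal (1 / sqrt 2)) * N"
    by (simp add: ac_simps)
  also have "ennreal (2 * sqrt 2) * ennreal (1 / sqrt 2) = ennreal 2"
    by (simp flip: ennreal_mult)
  finally have nn: "(\<integral>\<^sup>+z. ennreal ((norm (qstft_gauss I f z))\<^sup>2) \<partial>lborel) = ennreal 2 * N" .
  with \<open>N < \<infinity>\<close> have VL2: "qstft_gauss I f \<in> L2"
    by (intro L2I V_meas[unfolded borel_prod]) (simp add: ennreal_mult_less_top)
  \<comment> \<open>Both norms are now roots of the same quantity \<open>N\<close>, up to the factor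
    2.\<close>
  moreover have "L2_norm (qstft_gauss I f) = sqrt 2 * L2_norm f"
    unfolding L2_norm_eq[OF VL2] L2_norm_eq[OF assms(2)] nn N_f
    by (simp add: enn2real_mult real_sqrt_mult)
  ultimately show ?thesis ..
qed

end
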